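(* Let $\mathbb{A}$ be a countable fragment of $\mathcal{L}_{\mathsf{DPL}_{\omega_1}}$ and let $\Gamma\cup\{\varphi\}\subseteq\mathbb{A}$. If $\Gamma\vDash\varphi$ (semantic consequence over the class of all dynamic Markov processes), then $\Gamma\vdash_{\omega_1}\varphi$.
   Context: Language. $\mathbb{P}$ is a countable set of propositional variables. $\mathcal{L}_{\mathsf{DPL}_{\omega_1}}$-formulas: $\varphi ::= p\mid\neg\varphi\mid\bigwedge_{i\in I}\varphi_i\mid L_r\varphi\mid\bigcirc\varphi$ with $p\in\mathbb{P}$, $I$ countable, $r\in\mathbb{Q}\cap[0,1]$. Other connectives, including countable $\bigvee$, are the usual abbreviations; $M_r\varphi:=L_{1-r}\neg\varphi$. $\mathbb{F}$ is the set of finitary formulas, i.e. those built from $p,\neg,\wedge$ (binary)$,L_r,\bigcirc$. All indices $r,s$ range over $\mathbb{Q}\cap[0,1]$. Fragments. The formal negation $\sim\varphi$ is: $\sim p=\neg p$; $\sim(\neg\varphi)=\varphi$; $\sim(\bigwedge_{i\in I}\varphi_i)=\bigvee_{i\in I}\sim\varphi_i$; $\sim(L_r\varphi)=\neg M_{1-r}\sim\varphi$; $\sim(\bigcirc\varphi)=\bigcirc\sim\varphi$. A countable fragment is a countable set $\mathbb{A}$ of formulas with $\mathbb{F}\subseteq\mathbb{A}$, closed under $\neg$, binary $\wedge$, all $L_r$, $\bigcirc$, formal negation $\sim$, and subformulas (the subformulas of $\varphi$ form the least set containing $\varphi$, containing $\psi$ whenever it contains $\neg\psi$, $L_r\psi$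 or $\bigcirc\psi$, and containing each $\psi_i$ whenever it contains $\bigwedge_{i\in I}\psi_i$). Semantics. A dynamic Markov process is $\langle\Omega,\mathcal{A},T,f\rangle$ with $\langle\Omega,\mathcal{A}\rangle$ a measurable space ($\Omega\ne\emptyset$), $T:\Omega\times\mathcal{A}\to[0,1]$ a Markov kernel (each $T(w,\cdot)$ is a $\sigma$-additive probability measure, each $T(\cdot,A)$ is measurable), $f:\Omega\to\Omega$ measurable. A model $\mathfrak{M}$ adds a valuation $v:\mathbb{P}\to\mathcal{A}$. Satisfaction: $\mathfrak{M},w\vDash p$ iff $w\in v(p)$; $\neg$ as usual; $\mathfrak{M},w\vDash\bigwedge_{i\in I}\varphi_i$ iff $\mathfrak{M},w\vDash\varphi_i$ for all $i$; $\mathfrak{M},w\vDash L_r\varphi$ iff $T(w,\{u:\mathfrak{M},u\vDash\varphi\})\ge r$; $\mathfrak{M},w\vDash\bigcirc\varphi$ iff $\mathfrak{M},f(w)\vDash\varphi$. $\Gamma\vDash\varphi$ means: for every model $\mathfrak{M}$ and world $w$, if all members of $\Gamma$ hold at $w$ then $\varphi$ holds at $w$. Proof system $\mathcal{H}_{\mathsf{DPL}_{\omega_1}}$. Axiom schemes: all infinitary propositional tautologies; $L_0\bot$; $L_r\neg\varphi\to\neg L_s\varphi$ if $r+s>1$; $L_r(\varphi\wedge\psi)\wedge L_s(\varphi\wedge\neg\psi)\to L_{r+s}\varphi$ if $r+s\le1$; $\neg L_r(\varphi\wedge\psi)\wedge\neg L_s(\varphi\wedge\neg\psi)\to\neg L_{r+s}\varphi$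 if $r+s\le1$; $L_1(\varphi\to\psi)\to(L_r\varphi\to L_r\psi)$; $\bigwedge_{s<r}L_s\varphi\to L_r\varphi$; $\bigwedge_{0<n\in\mathbb{N}}\bigvee_{k\in\mathbb{N}}\neg L_{1/n}(\bigwedge_{i\le k}\varphi_i\wedge\neg\bigwedge_{i\in\mathbb{N}}\varphi_i)$; $\bigcirc\neg\varphi\leftrightarrow\neg\bigcirc\varphi$; $\bigcirc\bigwedge_{i\in I}\varphi_i\leftrightarrow\bigwedge_{i\in I}\bigcirc\varphi_i$ ($I$ countable). Rules: modus ponens; from $\{\psi\to\varphi_i\mid i\in I\}$ ($I$ countable) infer $\psi\to\bigwedge_{i\in I}\varphi_i$; from $\{\psi\to\bigcirc^nL_s\varphi\mid s<r\}$ infer $\psi\to\bigcirc^nL_r\varphi$ ($n\in\mathbb{N}$); $\mathrm{Nec}_{L_1}$: from $\varphi$ infer $L_1\varphi$; $\mathrm{Nec}_\bigcirc$: from $\varphi$ infer $\bigcirc\varphi$. A theorem ($\vdash_{\omega_1}\varphi$) is the last formula of a sequence indexed by the ordinals $\le\alpha+1$ (with $\alpha+1<\omega_1$), each member of which is an axiom or follows from earlier members by a rule. $\Gamma\vdash_{\omega_1}\varphi$ means there is such a sequence ending in $\varphi$ in which each member is in $\Gamma$, or is a theorem, or follows from earlier members by a rule other than $\mathrm{Nec}_{L_1}$ and $\mathrm{Nec}_\bigcirc$. *)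

theory Defs
  imports "HOL-Probability.Probability"
begin

typedef index = "{r::rat. 0 \<le> r \<and> r \<le> 1}"
  morphisms rat_of_index index_of_rat
  by (rule exI[of _ 0]) simp

text \<open>A conjunction takes a countable family as a partial function on the natural numbers:
  the index set \<open>I\<close> is its domain, so the empty family is allowed.\<close>

datatype 'p fm =
    Prop 'p
  | Neg "'p fm"
  | Conj "nat \<rightharpoonup> 'p fm"
  | Lik index "'p fm"
  | Next "'p fm"

definition family :: "nat set \<Rightarrow> (nat \<Rightarrow> 'p fm) \<Rightarrow> nat \<rightharpoonup> 'p fm" where
  "family I \<phi> = (\<lambda>i. if i \<in> I then Some (\<phi> i) else None)"

definition Disj :: "(nat \<rightharpoonup> 'p fm) \<Rightarrow> 'p fm" where
  "Disj F = Neg (Conj (map_option Neg \<circ> F))"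

definition And :: "'p fm \<Rightarrow> 'p fm \<Rightarrow> 'p fm" where
  "And \<phi> \<psi> = Conj [0 \<mapsto> \<phi>, 1 \<mapsto> \<psi>]"

definition Imp :: "'p fm \<Rightarrow> 'p fm \<Rightarrow> 'p fm" where
  "Imp \<phi> \<psi> = Neg (And \<phi> (Neg \<psi>))"

definition Iff :: "'p fm \<Rightarrow> 'p fm \<Rightarrow> 'p fm" where
  "Iff \<phi> \<psi> = And (Imp \<phi> \<psi>) (Imp \<psi> \<phi>)"

definition Bot :: "'p fm" where
  "Bot = Disj Map.empty"

definition Mup :: "index \<Rightarrow> 'p fm \<Rightarrow> 'p fm" where
  "Mup r \<phi> = Lik (index_of_rat (1 - rat_of_index r)) (Neg \<phi>)"


subsection \<open>Fragments\<close>

inductive_set finitary :: "'p fm set" where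
  "Prop p \<in> finitary"
| "\<phi> \<in> finitary \<Longrightarrow> Neg \<phi> \<in> finitary"
| "\<phi> \<in> finitary \<Longrightarrow> \<psi> \<in> finitary \<Longrightarrow> And \<phi> \<psi> \<in> finitary"
| "\<phi> \<in> finitary \<Longrightarrow> Lik r \<phi> \<in> finitary"
| "\<phi> \<in> finitary \<Longrightarrow> Next \<phi> \<in> finitary"

primrec formal_neg :: "'p fm \<Rightarrow> 'p fm" where
  "formal_neg (Prop p) = Neg (Prop p)"
| "formal_neg (Neg \<phi>) = \<phi>"
| "formal_neg (Conj F) = Disj (map_option formal_neg \<circ> F)"
| "formal_neg (Lik r \<phi>) = Neg (Mup (index_of_rat (1 - rat_of_index r)) (formal_neg \<phi>))"
| "formal_neg (Next \<phi>) = Next (formal_neg \<phi>)"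

inductive_set subformulas :: "'p fm \<Rightarrow> 'p fm set" for \<phi> :: "'p fm" where
  "\<phi> \<in> subformulas \<phi>"
| "Neg \<psi> \<in> subformulas \<phi> \<Longrightarrow> \<psi> \<in> subformulas \<phi>"
| "Lik r \<psi> \<in> subformulas \<phi> \<Longrightarrow> \<psi> \<in> subformulas \<phi>"
| "Next \<psi> \<in> subformulas \<phi> \<Longrightarrow> \<psi> \<in> subformulas \<phi>"
| "Conj F \<in> subformulas \<phi> \<Longrightarrow> F i = Some \<psi> \<Longrightarrow> \<psi> \<in> subformulas \<phi>"

definition countable_fragment :: "'p fm set \<Rightarrow> bool" where
  "countable_fragment A \<longleftrightarrow>
     countable A \<and> finitary \<subseteq> A \<and>
     (\<forall>\<phi>\<in>A. Neg \<phi> \<in> A) \<and>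
     (\<forall>\<phi>\<in>A. \<forall>\<psi>\<in>A. And \<phi> \<psi> \<in> A) \<and>
     (\<forall>\<phi>\<in>A. \<forall>r. Lik r \<phi> \<in> A) \<and>
     (\<forall>\<phi>\<in>A. Next \<phi> \<in> A) \<and>
     (\<forall>\<phi>\<in>A. formal_neg \<phi> \<in> A) \<and>
     (\<forall>\<phi>\<in>A. subformulas \<phi> \<subseteq> A)"


subsection \<open>Semantics\<close>

text \<open>Of the measure \<open>M\<close> only the measurable space is used. Membership of \<open>T\<close> in
  \<open>M \<rightarrow>\<^sub>M prob_algebra M\<close> says that each \<open>T w\<close> is a probability measure on that space and that
  each \<open>w \<mapsto> T w A\<close>, with \<open>A\<close> measurable, is measurable.\<close>

definition dynamic_markov_process :: "'w measure \<Rightarrow> ('w \<Rightarrow> 'w measure) \<Rightarrow> ('w \<Rightarrow> 'w) \<Rightarrow> bool" where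
  "dynamic_markov_process M T f \<longleftrightarrow>
     space M \<noteq> {} \<and> T \<in> M \<rightarrow>\<^sub>M prob_algebra M \<and> f \<in> M \<rightarrow>\<^sub>M M"

definition is_model ::
  "'w measure \<Rightarrow> ('w \<Rightarrow> 'w measure) \<Rightarrow> ('w \<Rightarrow> 'w) \<Rightarrow> ('p \<Rightarrow> 'w set) \<Rightarrow> bool" where
  "is_model M T f v \<longleftrightarrow> dynamic_markov_process M T f \<and> (\<forall>p. v p \<in> sets M)"

primrec sat ::
  "'w measure \<Rightarrow> ('w \<Rightarrow> 'w measure) \<Rightarrow> ('w \<Rightarrow> 'w) \<Rightarrow> ('p \<Rightarrow> 'w set) \<Rightarrow> 'p fm \<Rightarrow> 'w \<Rightarrow> bool" where
  "sat M T f v (Prop p) = (\<lambda>w. w \<in> v p)"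
| "sat M T f v (Neg \<phi>) = (\<lambda>w. \<not> sat M T f v \<phi> w)"
| "sat M T f v (Conj F) = (\<lambda>w. \<forall>S \<in> ran (map_option (sat M T f v) \<circ> F). S w)"
| "sat M T f v (Lik r \<phi>) =
     (\<lambda>w. measure (T w) {u \<in> space M. sat M T f v \<phi> u} \<ge> of_rat (rat_of_index r))"
| "sat M T f v (Next \<phi>) = (\<lambda>w. sat M T f v \<phi> (f w))"

lemma sat_Conj_iff: "sat M T f v (Conj F) w \<longleftrightarrow> (\<forall>i \<psi>. F i = Some \<psi> \<longrightarrow> sat M T f v \<psi> w)"
  by (auto simp: ran_def)

text \<open>HOL cannot quantify over types inside a formula, so the type \<open>'w\<close> that worlds are drawn from
  is an explicit parameter; \<open>space M\<close> may be any nonempty subset of it. Consequence over all models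
  implies \<open>entails TYPE('w)\<close> for each \<open>'w\<close>. The natural choice for completeness is \<open>'p fm set\<close>,
  which contains every canonical model (its worlds are sets of formulas).\<close>

definition entails :: "'w itself \<Rightarrow> 'p fm set \<Rightarrow> 'p fm \<Rightarrow> bool" where
  "entails W \<Gamma> \<phi> \<longleftrightarrow>
     (\<forall>(M :: 'w measure) T f v. is_model M T f v \<longrightarrow>
        (\<forall>w \<in> space M. (\<forall>\<gamma>\<in>\<Gamma>. sat M T f v \<gamma> w) \<longrightarrow> sat M T f v \<phi> w))"


subsection \<open>Proof system\<close>

text \<open>Propositional evaluation: variables, \<open>Lik\<close>- and \<open>Next\<close>-formulas count as atoms.\<close>

primrec prop_eval :: "('p fm \<Rightarrow> bool) \<Rightarrow> 'p fm \<Rightarrow> bool" where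
  "prop_eval \<nu> (Prop p) \<longleftrightarrow> \<nu> (Prop p)"
| "prop_eval \<nu> (Neg \<phi>) \<longleftrightarrow> \<not> prop_eval \<nu> \<phi>"
| "prop_eval \<nu> (Conj F) \<longleftrightarrow> (\<forall>b \<in> ran (map_option (prop_eval \<nu>) \<circ> F). b)"
| "prop_eval \<nu> (Lik r \<phi>) \<longleftrightarrow> \<nu> (Lik r \<phi>)"
| "prop_eval \<nu> (Next \<phi>) \<longleftrightarrow> \<nu> (Next \<phi>)"

lemma prop_eval_Conj_iff:
  "prop_eval \<nu> (Conj F) \<longleftrightarrow> (\<forall>i \<psi>. F i = Some \<psi> \<longrightarrow> prop_eval \<nu> \<psi>)"
  by (auto simp: ran_def)

definition tautology :: "'p fm \<Rightarrow> bool" where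
  "tautology \<phi> \<longleftrightarrow> (\<forall>\<nu>. prop_eval \<nu> \<phi>)"

text \<open>In the two additivity axioms the index \<open>t\<close> is \<open>r + s\<close>; that it is an index is the side
  condition \<open>r + s \<le> 1\<close>. In the Archimedean axiom any enumeration \<open>F\<close> of the formulas \<open>Lik s \<phi>\<close>,
  \<open>s < r\<close>, is admitted.\<close>

inductive is_axiom :: "'p fm \<Rightarrow> bool" where
  taut: "tautology \<phi> \<Longrightarrow> is_axiom \<phi>"
| lik_zero: "is_axiom (Lik (index_of_rat 0) Bot)"
| lik_neg: "rat_of_index r + rat_of_index s > 1 \<Longrightarrow>
    is_axiom (Imp (Lik r (Neg \<phi>)) (Neg (Lik s \<phi>)))"
| lik_add: "rat_of_index t = rat_of_index r + rat_of_index s \<Longrightarrow>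
    is_axiom (Imp (And (Lik r (And \<phi> \<psi>)) (Lik s (And \<phi> (Neg \<psi>)))) (Lik t \<phi>))"
| lik_subadd: "rat_of_index t = rat_of_index r + rat_of_index s \<Longrightarrow>
    is_axiom (Imp (And (Neg (Lik r (And \<phi> \<psi>))) (Neg (Lik s (And \<phi> (Neg \<psi>))))) (Neg (Lik t \<phi>)))"
| lik_mono: "is_axiom (Imp (Lik (index_of_rat 1) (Imp \<phi> \<psi>)) (Imp (Lik r \<phi>) (Lik r \<psi>)))"
| lik_arch: "ran F = {Lik s \<phi> | s. rat_of_index s < rat_of_index r} \<Longrightarrow>
    is_axiom (Imp (Conj F) (Lik r \<phi>))"
| lik_cont: "is_axiom
    (Conj (family {0<..} (\<lambda>n.
       Disj (family UNIV (\<lambda>k.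
         Neg (Lik (index_of_rat (1 / of_nat n))
           (And (Conj (family {..k} \<phi>)) (Neg (Conj (family UNIV \<phi>))))))))))"
| next_neg: "is_axiom (Iff (Next (Neg \<phi>)) (Neg (Next \<phi>)))"
| next_conj: "is_axiom (Iff (Next (Conj F)) (Conj (map_option Next \<circ> F)))"

text \<open>Rules relate the set of premises to the conclusion.\<close>

inductive basic_rule :: "'p fm set \<Rightarrow> 'p fm \<Rightarrow> bool" where
  mp: "basic_rule {\<phi>, Imp \<phi> \<psi>} \<psi>"
| conj: "basic_rule {Imp \<psi> \<theta> | \<theta>. \<theta> \<in> ran F} (Imp \<psi> (Conj F))"
| arch: "basic_rule {Imp \<psi> ((Next ^^ n) (Lik s \<phi>)) | s. rat_of_index s < rat_of_index r}
    (Imp \<psi> ((Next ^^ n) (Lik r \<phi>)))"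

inductive nec_rule :: "'p fm set \<Rightarrow> 'p fm \<Rightarrow> bool" where
  nec_lik: "nec_rule {\<phi>} (Lik (index_of_rat 1) \<phi>)"
| nec_next: "nec_rule {\<phi>} (Next \<phi>)"

text \<open>A sequence indexed by the ordinals up to \<open>\<alpha> + 1 < \<omega>\<^sub>1\<close> is encoded by a well-order \<open>R\<close> on a set
  of natural numbers together with \<open>\<sigma>\<close> on its field; \<open>top\<close> and \<open>pre\<close> are the positions \<open>\<alpha> + 1\<close>
  and \<open>\<alpha>\<close>, and \<open>underS R i\<close> is the set of positions before \<open>i\<close>.\<close>

definition has_proof :: "('a \<Rightarrow> bool) \<Rightarrow> ('a set \<Rightarrow> 'a \<Rightarrow> bool) \<Rightarrow> 'a \<Rightarrow> bool" where
  "has_proof base rule \<phi> \<longleftrightarrow>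
     (\<exists>(R :: nat rel) \<sigma> top pre.
        Well_order R \<and>
        top \<in> Field R \<and> (\<forall>i\<in>Field R. (i, top) \<in> R) \<and>
        pre \<in> underS R top \<and> (\<forall>i\<in>underS R top. (i, pre) \<in> R) \<and>
        (\<forall>i\<in>Field R. base (\<sigma> i) \<or> (\<exists>P \<subseteq> \<sigma> ` underS R i. rule P (\<sigma> i))) \<and>
        \<sigma> top = \<phi>)"

definition is_theorem :: "'p fm \<Rightarrow> bool" where
  "is_theorem = has_proof is_axiom (\<lambda>P \<phi>. basic_rule P \<phi> \<or> nec_rule P \<phi>)"

definition derives :: "'p fm set \<Rightarrow> 'p fm \<Rightarrow> bool" where
  "derives \<Gamma> = has_proof (\<lambda>\<phi>. \<phi> \<in> \<Gamma> \<or> is_theorem \<phi>) basic_rule"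

end

theory Submission
  imports Defs
begin

text \<open>
  Since \<open>\<Gamma>\<close> is countable, it may be replaced by one formula, the conjunction of its members: if
  \<open>\<And>\<Gamma> \<rightarrow> \<phi>\<close> is a theorem, then \<open>\<phi>\<close> follows from \<open>\<Gamma>\<close> by the conjunction rule and modus ponens
  (\<open>derives_of_provable_conj\<close>). It remains to build a model of every formula \<open>c\<close> whose negation is
  not a theorem. The worlds of this model are sets of formulas from a language, called \<open>A\<close> in the
  locale \<open>closed_language\<close>, that is the closure of \<open>c\<close> under subformulas, the finitary connectives,
  and the infinitary formulas that the construction speaks about: the conjunctions of all \<open>L\<^sub>s a\<close>
  with \<open>s < r\<close>, the instances of the continuity axiom, and \<open>\<And>\<^sub>i \<circle>a\<^sub>i\<close> together with \<open>\<And>\<^sub>i a\<^sub>i\<close>. The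
  closure operations have finitely many arguments, so \<open>A\<close> is countable.

  Worlds are the complete sets of \<open>A\<close>-formulas that contain all theorems and treat the conjunctions
  in \<open>A\<close> correctly. Both existence results about worlds come from one omitting-types argument
  (\<open>world_from_chain\<close>): a decreasing sequence of consistent formulas extends to an ultrafilter, and
  the ultrafilter respects \<open>\<And>\<^sub>i a\<^sub>i\<close> if some member of the sequence reduces this conjunction to
  finitely many of the \<open>a\<^sub>i\<close>. With witnesses chosen by the conjunction rule this gives a world through
  every consistent formula (\<open>world_exists\<close>).

  At a world \<open>w\<close> the number \<open>\<mu>(a) = sup {r. L\<^sub>r a \<in> w}\<close> is a finitely additive probability on formulas.
  The heart of the proof is that it is countably additive on the truth sets of formulas, that is,
  that a decreasing sequence \<open>b\<^sub>n\<close> with \<open>\<mu>(b\<^sub>n) \<ge> e > 0\<close> has a world common to all of its members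
  (\<open>world_of_large_chain\<close>). By the continuity axiom, the \<open>n\<close>-th conjunction of \<open>A\<close> has a finite part
  such that the formula saying that this part holds while the conjunction fails has probability
  below \<open>e / 2\<^sup>n\<^sup>+\<^sup>2\<close>. Excluding all these formulas costs at most \<open>e / 2\<close> in total, so what is left is
  still consistent, and the omitting-types argument applies. Caratheodory's extension theorem then
  yields the transition kernel, \<open>\<circle>\<close> is interpreted by \<open>w \<mapsto> {a. \<circle>a \<in> w}\<close>, and the usual
  truth lemma shows that a world satisfies exactly its members.
\<close>

section \<open>Proofs along countable well-orders\<close>

text \<open>The positions of a proof may be taken from any countable type, because an injection into the
  natural numbers carries the well-order and the justifications along.\<close>

lemma has_proof_transport:
  fixes R :: "'i::countable rel"
  assumes wo: "Well_order R"
    and final: "final \<in> Field R" "\<And>i. i \<in> Field R \<Longrightarrow> (i, final) \<in> R"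
    and pre: "pre \<in> underS R final" "\<And>i. i \<in> underS R final \<Longrightarrow> (i, pre) \<in> R"
    and just: "\<And>i. i \<in> Field R \<Longrightarrow> base (\<sigma> i) \<or> (\<exists>P \<subseteq> \<sigma> ` underS R i. rule P (\<sigma> i))"
  shows "has_proof base rule (\<sigma> final)"
proof -
  let ?R = "dir_image R to_nat"
  have inj: "inj_on to_nat (Field R)" by (rule inj_on_subset[OF inj_to_nat]) simp
  have field: "Field ?R = to_nat ` Field R" by (rule dir_image_Field)
  have mem: "(to_nat i, to_nat j) \<in> ?R \<longleftrightarrow> (i, j) \<in> R" for i j
    by (auto simp: dir_image_def)
  have under: "underS ?R (to_nat i) = to_nat ` underS R i" for i
    by (auto simp: underS_def dir_image_def image_iff)
  have wo': "Well_order ?R" by (rule Well_order_dir_image[OF wo inj])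
  have just': "base ((\<sigma> \<circ> from_nat) i) \<or>
      (\<exists>P \<subseteq> (\<sigma> \<circ> from_nat) ` underS ?R i. rule P ((\<sigma> \<circ> from_nat) i))"
    if i: "i \<in> Field ?R" for i
  proof -
    obtain j where j: "j \<in> Field R" "i = to_nat j" using i by (auto simp: field)
    have "(\<sigma> \<circ> from_nat) ` underS ?R i = \<sigma> ` underS R j"
      by (auto simp: j under image_image)
    then show ?thesis using just[OF j(1)] by (simp add: j(2))
  qed
  show ?thesis
    unfolding has_proof_def
    by (rule exI[of _ ?R], rule exI[of _ "\<sigma> \<circ> from_nat"], rule exI[of _ "to_nat final"],
        rule exI[of _ "to_nat pre"])
      (use final pre wo' just' in \<open>auto simp: mem field under\<close>)
qed

text \<open>The lexicographic sum of the well-orders \<open>S a\<close>, with the blocks in the order of their indices.\<close>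

definition wo_sum :: "('k::wellorder \<Rightarrow> 'a rel) \<Rightarrow> ('k \<times> 'a) rel" where
  "wo_sum S = {((a, x), (b, y)). x \<in> Field (S a) \<and> y \<in> Field (S b) \<and>
     (a < b \<or> a = b \<and> (x, y) \<in> S a)}"

lemma wo_sum_iff:
  "((a, x), (b, y)) \<in> wo_sum S \<longleftrightarrow>
     x \<in> Field (S a) \<and> y \<in> Field (S b) \<and> (a < b \<or> a = b \<and> (x, y) \<in> S a)"
  by (simp add: wo_sum_def)

lemma Field_wo_sum:
  assumes "\<And>a. Well_order (S a)"
  shows "Field (wo_sum S) = {(a, x). x \<in> Field (S a)}"
proof -
  have "(x, x) \<in> S a" if "x \<in> Field (S a)" for a x
    using assms[of a] that refl_onD[of "Field (S a)" "S a" x] unfolding order_on_defs by blast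
  then have "((a, x), (a, x)) \<in> wo_sum S" if "x \<in> Field (S a)" for a x
    using that by (simp add: wo_sum_iff)
  moreover have "snd p \<in> Field (S (fst p))" if "p \<in> Field (wo_sum S)" for p
  proof -
    obtain q where "(p, q) \<in> wo_sum S \<or> (q, p) \<in> wo_sum S"
      using \<open>p \<in> Field (wo_sum S)\<close> unfolding Field_def by blast
    then show ?thesis by (cases p; cases q) (auto simp: wo_sum_iff)
  qed
  ultimately show ?thesis by (auto intro: FieldI1)
qed

lemma Well_order_wo_sum:
  assumes wo: "\<And>a. Well_order (S a)"
  shows "Well_order (wo_sum S)"
proof -
  have lin: "Refl (S a)" "trans (S a)" "antisym (S a)" "Total (S a)" for a
    using wo[of a] unfolding order_on_defs by auto
  have r: "(x, x) \<in> S a" if "x \<in> Field (S a)" for a x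
    using lin(1) that by (rule refl_onD)
  have t: "(x, z) \<in> S a" if "(x, y) \<in> S a" "(y, z) \<in> S a" for a x y z
    using lin(2) that by (rule transD)
  have as: "x = y" if "(x, y) \<in> S a" "(y, x) \<in> S a" for a x y
    using lin(3) that by (rule antisymD)
  have tot: "(x, y) \<in> S a \<or> (y, x) \<in> S a" if "x \<in> Field (S a)" "y \<in> Field (S a)" for a x y
    using lin(4)[of a] r[of x a] that by (cases "x = y") (auto simp: total_on_def)
  note F = Field_wo_sum[of S, OF wo]
  have "Linear_order (wo_sum S)"
    unfolding order_on_defs
  proof (intro conjI)
    show "Refl (wo_sum S)" unfolding refl_on_def F by (auto simp: wo_sum_iff r)
    show "trans (wo_sum S)"
      by (rule transI) (auto simp: wo_sum_iff intro: t)
    show "antisym (wo_sum S)" by (rule antisymI) (auto simp: wo_sum_iff dest: as)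
    show "Total (wo_sum S)"
      unfolding total_on_def F by (auto simp: wo_sum_iff dest: tot)
  qed (auto intro: FieldI1 FieldI2)
  moreover have "\<exists>p\<in>Q. \<forall>q\<in>Q. (p, q) \<in> wo_sum S" if Q: "Q \<subseteq> Field (wo_sum S)" "Q \<noteq> {}" for Q
  proof -
    define a where "a = (LEAST a. \<exists>x. (a, x) \<in> Q)"
    obtain a' x' where "(a', x') \<in> Q" using Q(2) by auto
    then have "\<exists>x. (a', x) \<in> Q" by blast
    then have a: "\<exists>x. (a, x) \<in> Q" unfolding a_def by (rule LeastI)
    have al: "a \<le> b" if "(b, y) \<in> Q" for b y
      unfolding a_def by (rule Least_le) (use that in blast)
    define X where "X = {x. (a, x) \<in> Q}"
    have X: "X \<subseteq> Field (S a)" "X \<noteq> {}" using Q(1) a by (auto simp: X_def F)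
    then obtain x where x: "x \<in> X" "\<forall>y\<in>X. (x, y) \<in> S a"
      using wo[of a] Linear_order_Well_order_iff[of "S a"]
      by (metis well_order_on_def)
    have "((a, x), q) \<in> wo_sum S" if "q \<in> Q" for q
    proof (cases q)
      case (Pair b y)
      show ?thesis
        using that x al[of b y] Q(1) X unfolding Pair
        by (cases "a = b") (auto simp: wo_sum_iff X_def F)
    qed
    then show ?thesis using x(1) by (intro bexI[of _ "(a, x)"]) (auto simp: X_def)
  qed
  ultimately show ?thesis by (simp add: Linear_order_Well_order_iff)
qed

text \<open>Proofs of the premises are placed one after the other, and the conclusion is put behind all of
  them. The conclusion occurs twice because the last position has to be a successor: a well-order
  that ends with the limit of infinitely many blocks and one further position has no
  predecessor of that position, whereas the first copy of the conclusion precedes the second one.\<close>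

lemma has_proof_step:
  assumes P: "countable P" "\<And>p. p \<in> P \<Longrightarrow> has_proof base rule p"
    and \<phi>: "base \<phi> \<or> rule P \<phi>"
  shows "has_proof base rule \<phi>"
proof -
  define just where "just = (\<lambda>(R::nat rel) \<sigma> i. base (\<sigma> i) \<or> (\<exists>P \<subseteq> \<sigma> ` underS R i. rule P (\<sigma> i)))"
  have "\<exists>R \<sigma> t. Well_order (R :: nat rel) \<and> t \<in> Field R \<and> (\<forall>i\<in>Field R. just R \<sigma> i) \<and> \<sigma> t = p"
    if "p \<in> P" for p
    using P(2)[OF that] unfolding has_proof_def just_def by blast
  then obtain R \<sigma> t where R: "\<And>p. p \<in> P \<Longrightarrow> Well_order (R p :: nat rel) \<and> t p \<in> Field (R p) \<and>
      (\<forall>i\<in>Field (R p). just (R p) (\<sigma> p) i) \<and> \<sigma> p (t p) = p"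
    by metis
  \<comment> \<open>Block \<open>n\<close> is a proof of the premise with number \<open>n\<close>, block \<open>\<infinity>\<close> the two copies of \<open>\<phi>\<close>.\<close>
  define S :: "enat \<Rightarrow> nat rel" where
    "S a = (case a of enat n \<Rightarrow> if n \<in> to_nat_on P ` P then R (from_nat_into P n) else {}
       | \<infinity> \<Rightarrow> {(0, 0), (0, 1), (1, 1)})" for a
  define \<tau> where "\<tau> = (\<lambda>(a, x). case a of enat n \<Rightarrow> \<sigma> (from_nat_into P n) x | \<infinity> \<Rightarrow> \<phi>)"
  have inP: "from_nat_into P n \<in> P" if "n \<in> to_nat_on P ` P" for n
    using that P(1) by auto
  have wo: "Well_order (S a)" for a
  proof (cases a)
    case (enat n)
    then show ?thesis using R inP by (auto simp: S_def)
  next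
    case infinity
    have "Linear_order (S a)"
      by (auto simp: infinity S_def order_on_defs refl_on_def trans_def antisym_def total_on_def Field_def)
    moreover have "\<exists>x\<in>Q. \<forall>y\<in>Q. (x, y) \<in> S a" if "Q \<subseteq> Field (S a)" "Q \<noteq> {}" for Q
    proof (cases "0 \<in> Q")
      case True
      then show ?thesis using that(1) by (auto simp: infinity S_def Field_def)
    next
      case False
      then have "Q \<subseteq> {1}" using that(1) by (auto simp: infinity S_def Field_def)
      then have "Q = {1}" using that(2) by blast
      then show ?thesis by (simp add: infinity S_def)
    qed
    ultimately show ?thesis by (simp add: Linear_order_Well_order_iff)
  qed
  note F = Field_wo_sum[of S, OF wo]
  have Sinf: "S \<infinity> = {(0, 0), (0, 1), (1, 1)}" by (simp add: S_def)
  have Finf: "Field (S \<infinity>) = {0, 1}" by (auto simp: S_def Field_def)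
  have under: "underS (wo_sum S) (a, x) = {(b, y). y \<in> Field (S b) \<and> x \<in> Field (S a) \<and>
      (b < a \<or> b = a \<and> y \<in> underS (S a) x)}" for a x
    by (auto simp: underS_def wo_sum_iff)
  have "has_proof base rule (\<tau> (\<infinity>, 1))"
  proof (rule has_proof_transport[of "wo_sum S" "(\<infinity>, 1)" "(\<infinity>, 0)"])
    show "Well_order (wo_sum S)" by (rule Well_order_wo_sum[OF wo])
    show "(\<infinity>, 1) \<in> Field (wo_sum S)" by (simp add: F Finf)
    show "(i, (\<infinity>, 1)) \<in> wo_sum S" if "i \<in> Field (wo_sum S)" for i
      using that by (cases i; cases "fst i") (auto simp: F wo_sum_iff Finf Sinf)
    show "(\<infinity>, 0) \<in> underS (wo_sum S) (\<infinity>, 1)"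
      by (auto simp: underS_def wo_sum_iff Finf Sinf)
    show "(i, (\<infinity>, 0)) \<in> wo_sum S" if "i \<in> underS (wo_sum S) (\<infinity>, 1)" for i
      using that by (cases i; cases "fst i") (auto simp: under wo_sum_iff Finf Sinf underS_def)
    show "base (\<tau> i) \<or> (\<exists>Q \<subseteq> \<tau> ` underS (wo_sum S) i. rule Q (\<tau> i))"
      if i: "i \<in> Field (wo_sum S)" for i
    proof (cases i)
      case (Pair a x)
      show ?thesis
      proof (cases a)
        case (enat n)
        let ?p = "from_nat_into P n"
        have n: "n \<in> to_nat_on P ` P" and x: "x \<in> Field (S a)"
          using i by (auto simp: Pair enat F S_def split: if_splits)
        then have p: "?p \<in> P" and S: "S a = R ?p" using inP by (auto simp: enat S_def)
        have "just (R ?p) (\<sigma> ?p) x" using R[OF p] x S by simp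
        moreover have "\<sigma> ?p ` underS (R ?p) x \<subseteq> \<tau> ` underS (wo_sum S) i"
        proof
          fix z assume "z \<in> \<sigma> ?p ` underS (R ?p) x"
          then obtain y where y: "y \<in> underS (R ?p) x" "z = \<sigma> ?p y" by auto
          have "(a, y) \<in> underS (wo_sum S) i"
            using y(1) x by (auto simp: Pair under S) (auto simp: underS_def Field_def)
          moreover have "\<tau> (a, y) = z" by (simp add: \<tau>_def enat y)
          ultimately show "z \<in> \<tau> ` underS (wo_sum S) i" by blast
        qed
        moreover have "\<tau> i = \<sigma> ?p x" by (simp add: Pair enat \<tau>_def)
        ultimately show ?thesis unfolding just_def by (auto intro: order_trans)
      next
        case infinity
        have "P \<subseteq> \<tau> ` underS (wo_sum S) i"
        proof
          fix p assume p: "p \<in> P"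
          let ?n = "to_nat_on P p"
          have n: "from_nat_into P ?n = p" using p P(1) by simp
          have "S (enat ?n) = R p" using p n by (simp add: S_def)
          then have "(enat ?n, t p) \<in> underS (wo_sum S) i"
            using R[OF p] i by (auto simp: Pair infinity under F)
          moreover have "\<tau> (enat ?n, t p) = p" using R[OF p] n by (simp add: \<tau>_def)
          ultimately show "p \<in> \<tau> ` underS (wo_sum S) i" by force
        qed
        moreover have "\<tau> i = \<phi>" by (simp add: Pair infinity \<tau>_def)
        ultimately show ?thesis using \<phi> by auto
      qed
    qed
  qed
  then show ?thesis by (simp add: \<tau>_def)
qed

section \<open>Theorems and propositional reasoning\<close>

lemma countable_index: "countable (UNIV :: index set)"
proof -
  have "inj rat_of_index" by (simp add: inj_on_def rat_of_index_inject)
  then show ?thesis by (metis countable_image_inj_on countableI_type)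
qed

lemma rat_of_index_of_rat: "0 \<le> q \<Longrightarrow> q \<le> 1 \<Longrightarrow> rat_of_index (index_of_rat q) = q"
  by (simp add: index_of_rat_inverse)

abbreviation real_index :: "index \<Rightarrow> real" where
  "real_index r \<equiv> real_of_rat (rat_of_index r)"

abbreviation one_index :: index where "one_index \<equiv> index_of_rat 1"

definition Top :: "'p fm" where "Top = Neg Bot"

definition enumeration :: "'p fm set \<Rightarrow> nat \<rightharpoonup> 'p fm" where
  "enumeration X = (\<lambda>i. if i \<in> to_nat_on X ` X then Some (from_nat_into X i) else None)"

definition conj_set :: "'p fm set \<Rightarrow> 'p fm" where
  "conj_set X = Conj (enumeration X)"

lemma ran_enumeration:
  assumes "countable X"
  shows "ran (enumeration X) = X"
proof -
  have "from_nat_into X (to_nat_on X x) = x" if "x \<in> X" for x using assms that by simp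
  then show ?thesis using assms by (force simp: ran_def enumeration_def)
qed

lemma prop_eval_And [simp]: "prop_eval \<nu> (And a b) \<longleftrightarrow> prop_eval \<nu> a \<and> prop_eval \<nu> b"
  by (auto simp: And_def prop_eval_Conj_iff simp del: prop_eval.simps(3) split: if_splits)

lemma prop_eval_Imp [simp]: "prop_eval \<nu> (Imp a b) \<longleftrightarrow> (prop_eval \<nu> a \<longrightarrow> prop_eval \<nu> b)"
  by (auto simp: Imp_def)

lemma prop_eval_Bot [simp]: "\<not> prop_eval \<nu> Bot"
  by (simp add: Bot_def Disj_def)

lemma prop_eval_Top [simp]: "prop_eval \<nu> Top"
  by (simp add: Top_def)

text \<open>Theoremhood as an inductive closure, so that proofs can be extended without handling well-orders.
  The lemma \<open>provable_is_theorem\<close> turns membership in the closure back into a sequence.\<close>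

inductive provable :: "'p fm \<Rightarrow> bool" where
  ax: "is_axiom \<phi> \<Longrightarrow> provable \<phi>"
| rule: "(\<And>\<psi>. \<psi> \<in> P \<Longrightarrow> provable \<psi>) \<Longrightarrow> basic_rule P \<phi> \<or> nec_rule P \<phi> \<Longrightarrow> provable \<phi>"

lemma countable_ran_map: "countable (ran (F :: nat \<rightharpoonup> 'a))"
proof -
  have "ran F \<subseteq> range (\<lambda>i. the (F i))" by (auto simp: ran_def) (metis option.sel rangeI)
  then show ?thesis by (meson countable_subset countableI_type countable_image)
qed

lemma countable_rule:
  assumes "basic_rule P \<phi> \<or> nec_rule P \<phi>"
  shows "countable P"
  using assms
proof
  assume "basic_rule P \<phi>"
  then show ?thesis
  proof cases
    case (conj \<psi> F)
    have "P = Imp \<psi> ` ran F" using conj(1) by auto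
    then show ?thesis by (simp add: countable_ran_map)
  next
    case (arch \<psi> n \<phi> r)
    have "P \<subseteq> range (\<lambda>s. Imp \<psi> ((Next ^^ n) (Lik s \<phi>)))" using arch(1) by auto
    then show ?thesis by (rule countable_subset) (rule countable_image[OF countable_index])
  qed simp
qed (auto elim: nec_rule.cases)

lemma provable_is_theorem: "provable \<phi> \<Longrightarrow> is_theorem \<phi>"
proof (induction rule: provable.induct)
  case (ax \<phi>)
  show ?case unfolding is_theorem_def by (rule has_proof_step[of "{}"]) (use ax in simp_all)
next
  case (rule P \<phi>)
  show ?case
    unfolding is_theorem_def
    by (rule has_proof_step[OF countable_rule[OF rule.hyps(2)]])
      (use rule.IH rule.hyps(2) in \<open>simp_all add: is_theorem_def\<close>)
qed

lemma derives_base: "\<phi> \<in> \<Gamma> \<or> is_theorem \<phi> \<Longrightarrow> derives \<Gamma> \<phi>"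
  unfolding derives_def by (rule has_proof_step[of "{}"]) simp_all

lemma derives_rule:
  assumes "basic_rule P \<phi>" "\<And>\<psi>. \<psi> \<in> P \<Longrightarrow> derives \<Gamma> \<psi>"
  shows "derives \<Gamma> \<phi>"
  unfolding derives_def
  by (rule has_proof_step[OF countable_rule[OF disjI1[OF assms(1)]]])
    (use assms in \<open>simp_all add: derives_def\<close>)

lemma provable_mp: "provable (Imp a b) \<Longrightarrow> provable a \<Longrightarrow> provable b"
  by (rule provable.rule[of "{a, Imp a b}"]) (auto intro: basic_rule.mp)

lemma provable_taut: "(\<And>\<nu>. prop_eval \<nu> a) \<Longrightarrow> provable a"
  by (intro provable.ax is_axiom.taut) (simp add: tautology_def)

lemma provable_conseq1:
  "provable a \<Longrightarrow> (\<And>\<nu>. prop_eval \<nu> a \<Longrightarrow> prop_eval \<nu> b) \<Longrightarrow> provable b"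
  by (rule provable_mp[of a]) (auto intro: provable_taut)

lemma provable_conseq2:
  "provable a \<Longrightarrow> provable b \<Longrightarrow> (\<And>\<nu>. prop_eval \<nu> a \<Longrightarrow> prop_eval \<nu> b \<Longrightarrow> prop_eval \<nu> c) \<Longrightarrow> provable c"
  by (rule provable_mp[of b], rule provable_mp[of a]) (auto intro: provable_taut)

lemma provable_conj:
  assumes "\<And>\<theta>. \<theta> \<in> ran F \<Longrightarrow> provable (Imp a \<theta>)"
  shows "provable (Imp a (Conj F))"
  by (rule provable.rule[OF _ disjI1[OF basic_rule.conj]]) (use assms in auto)

lemma provable_nec: "provable a \<Longrightarrow> provable (Lik one_index a)"
  by (rule provable.rule[of "{a}"]) (auto intro: nec_rule.intros)

lemma provable_next: "provable a \<Longrightarrow> provable (Next a)"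
  by (rule provable.rule[of "{a}"]) (auto intro: nec_rule.intros)

text \<open>Every member of \<open>\<Gamma>\<close> is implied by \<open>Top\<close>, hence so is their conjunction, by the conjunction rule.\<close>

lemma derives_of_provable_conj:
  assumes c: "countable \<Gamma>" and p: "provable (Imp (conj_set \<Gamma>) \<phi>)"
  shows "derives \<Gamma> \<phi>"
proof -
  have prov: "derives \<Gamma> a" if "provable a" for a
    using derives_base provable_is_theorem that by blast
  have mp: "derives \<Gamma> b" if "derives \<Gamma> a" "derives \<Gamma> (Imp a b)" for a b
    by (rule derives_rule[OF basic_rule.mp[of a b]]) (use that in auto)
  have "derives \<Gamma> (Imp Top g)" if "g \<in> \<Gamma>" for g
    by (rule mp[OF derives_base prov]) (use that in \<open>auto intro: provable_taut\<close>)
  then have "derives \<Gamma> (Imp Top (conj_set \<Gamma>))"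
    using derives_rule[OF basic_rule.conj[of Top "enumeration \<Gamma>"]]
    unfolding conj_set_def ran_enumeration[OF c] by blast
  then have "derives \<Gamma> (conj_set \<Gamma>)" by (rule mp[OF prov[OF provable_taut], rotated]) simp
  then show ?thesis by (rule mp[OF _ prov[OF p]])
qed

section \<open>Monotonicity of the likelihood operators\<close>

lemma provable_Lik_mono: "provable (Imp a b) \<Longrightarrow> provable (Imp (Lik r a) (Lik r b))"
  by (rule provable_mp[OF provable.ax[OF is_axiom.lik_mono] provable_nec])

lemma provable_Lik_zero:
  assumes "rat_of_index r = 0"
  shows "provable (Lik r a)"
proof -
  have "r = index_of_rat 0" using assms by (metis rat_of_index_inverse)
  moreover have "provable (Imp (Lik (index_of_rat 0) Bot) (Lik (index_of_rat 0) a))"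
    by (rule provable_Lik_mono) (auto intro: provable_taut)
  ultimately show ?thesis using provable_mp provable.ax[OF is_axiom.lik_zero] by blast
qed

lemma provable_not_Lik:
  assumes a: "provable (Neg a)" and r: "rat_of_index r > 0"
  shows "provable (Neg (Lik r a))"
proof (rule provable_mp)
  show "provable (Lik one_index (Neg a))" by (rule provable_nec[OF a])
  show "provable (Imp (Lik one_index (Neg a)) (Neg (Lik r a)))"
    by (rule provable.ax[OF is_axiom.lik_neg]) (simp add: rat_of_index_of_rat r)
qed

text \<open>Apply the axiom \<open>lik_subadd\<close> to the splitting of \<open>a\<close> by \<open>Top\<close>, with bounds \<open>r\<close> and \<open>s - r\<close>: the part
  \<open>a \<and> \<not> Top\<close> is refutable, so its probability is below the positive number \<open>s - r\<close>.\<close>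

lemma provable_Lik_antimono:
  assumes rs: "rat_of_index r \<le> rat_of_index s"
  shows "provable (Imp (Lik s a) (Lik r a))"
proof (cases "rat_of_index r = rat_of_index s")
  case True
  then have "r = s" by (simp add: rat_of_index_inject)
  then show ?thesis by (auto intro: provable_taut)
next
  case False
  define t where "t = index_of_rat (rat_of_index s - rat_of_index r)"
  have bd: "0 \<le> rat_of_index r" "rat_of_index s \<le> 1" using rat_of_index by auto
  have t: "rat_of_index t = rat_of_index s - rat_of_index r"
    unfolding t_def by (rule rat_of_index_of_rat) (use rs bd in auto)
  have 1: "provable (Imp (And (Neg (Lik r (And a Top))) (Neg (Lik t (And a (Neg Top))))) (Neg (Lik s a)))"
    by (rule provable.ax[OF is_axiom.lik_subadd]) (simp add: t)
  have 2: "provable (Neg (Lik t (And a (Neg Top))))"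
    by (rule provable_not_Lik) (use rs False in \<open>auto simp: t intro: provable_taut\<close>)
  have 3: "provable (Imp (Lik r (And a Top)) (Lik r a))"
    by (rule provable_Lik_mono) (auto intro: provable_taut)
  have "provable (Imp (Neg (Lik r (And a Top))) (Neg (Lik s a)))"
    by (rule provable_conseq2[OF 1 2]) auto
  then show ?thesis by (rule provable_conseq2[OF _ 3]) auto
qed

section \<open>Ultrafilters\<close>

definition proper_filter :: "'p fm set \<Rightarrow> bool" where
  "proper_filter \<Phi> \<longleftrightarrow> (\<forall>a. provable a \<longrightarrow> a \<in> \<Phi>) \<and>
     (\<forall>a b. a \<in> \<Phi> \<longrightarrow> Imp a b \<in> \<Phi> \<longrightarrow> b \<in> \<Phi>) \<and> Bot \<notin> \<Phi>"

lemma proper_filterD: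
  assumes "proper_filter \<Phi>"
  shows "provable a \<Longrightarrow> a \<in> \<Phi>" "a \<in> \<Phi> \<Longrightarrow> Imp a b \<in> \<Phi> \<Longrightarrow> b \<in> \<Phi>" "Bot \<notin> \<Phi>"
  using assms unfolding proper_filter_def by blast+

lemma proper_filter_conseq:
  assumes "proper_filter \<Phi>" "a \<in> \<Phi>" "b \<in> \<Phi>"
    "\<And>\<nu>. prop_eval \<nu> a \<Longrightarrow> prop_eval \<nu> b \<Longrightarrow> prop_eval \<nu> c"
  shows "c \<in> \<Phi>"
proof -
  have "Imp a (Imp b c) \<in> \<Phi>" using assms by (intro proper_filterD(1) provable_taut) auto
  then show ?thesis using assms proper_filterD(2) by blast
qed

text \<open>Zorn's lemma gives a maximal proper filter. If it contained neither \<open>a\<close> nor \<open>\<not> a\<close>, the formulas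
  that it derives from \<open>a\<close> would form a larger one.\<close>

lemma ultrafilter_exists:
  assumes \<Phi>: "proper_filter \<Phi>"
  shows "\<exists>u. proper_filter u \<and> \<Phi> \<subseteq> u \<and> (\<forall>a. a \<in> u \<or> Neg a \<in> u)"
proof -
  define \<F> where "\<F> = {u. proper_filter u \<and> \<Phi> \<subseteq> u}"
  have "\<exists>u\<in>\<F>. \<forall>X\<in>\<F>. u \<subseteq> X \<longrightarrow> X = u"
  proof (rule subset_Zorn_nonempty)
    show "\<F> \<noteq> {}" using \<Phi> by (auto simp: \<F>_def)
    fix \<C> assume C: "\<C> \<noteq> {}" "subset.chain \<F> \<C>"
    have sub: "proper_filter u" "\<Phi> \<subseteq> u" if "u \<in> \<C>" for u
      using C(2) that unfolding subset_chain_def \<F>_def by blast+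
    have ch: "u \<subseteq> v \<or> v \<subseteq> u" if "u \<in> \<C>" "v \<in> \<C>" for u v
      using C(2) that unfolding subset_chain_def by blast
    have "b \<in> \<Union>\<C>" if ab: "a \<in> \<Union>\<C>" "Imp a b \<in> \<Union>\<C>" for a b
    proof -
      obtain u v where uv: "u \<in> \<C>" "v \<in> \<C>" "a \<in> u" "Imp a b \<in> v" using ab by blast
      from ch[OF uv(1,2)] show ?thesis
      proof
        assume "u \<subseteq> v"
        then show ?thesis using proper_filterD(2)[OF sub(1)[OF uv(2)], of a b] uv by blast
      next
        assume "v \<subseteq> u"
        then show ?thesis using proper_filterD(2)[OF sub(1)[OF uv(1)], of a b] uv by blast
      qed
    qed
    moreover have "a \<in> \<Union>\<C>" if "provable a" for a
      using C(1) proper_filterD(1)[OF sub(1) that] by blast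
    moreover have "Bot \<notin> \<Union>\<C>" using proper_filterD(3)[OF sub(1)] by blast
    ultimately have "proper_filter (\<Union>\<C>)" unfolding proper_filter_def by blast
    then show "\<Union>\<C> \<in> \<F>" using C(1) sub by (auto simp: \<F>_def)
  qed
  then obtain u where u': "u \<in> \<F>" "\<forall>X\<in>\<F>. u \<subseteq> X \<longrightarrow> X = u" by blast
  then have u: "proper_filter u" "\<Phi> \<subseteq> u" by (simp_all add: \<F>_def)
  have max: "v = u" if "proper_filter v" "u \<subseteq> v" for v
    using u'(2) that u(2) unfolding \<F>_def by blast
  have "Neg a \<in> u" if a: "a \<notin> u" for a
  proof (rule ccontr)
    assume na: "Neg a \<notin> u"
    define v where "v = {b. Imp a b \<in> u}"
    have uv: "u \<subseteq> v"
    proof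
      fix b assume "b \<in> u"
      then have "Imp a b \<in> u" using proper_filter_conseq[OF u(1), of b b "Imp a b"] by simp
      then show "b \<in> v" by (simp add: v_def)
    qed
    have "c \<in> v" if bc: "b \<in> v" "Imp b c \<in> v" for b c
    proof -
      have "Imp a c \<in> u"
        by (rule proper_filter_conseq[OF u(1), of "Imp a b" "Imp a (Imp b c)"])
          (use bc in \<open>simp_all add: v_def\<close>)
      then show ?thesis by (simp add: v_def)
    qed
    moreover have "b \<in> v" if "provable b" for b
      using that proper_filterD(1)[OF u(1)] uv by blast
    moreover have "Bot \<notin> v"
      using na proper_filter_conseq[OF u(1), of "Imp a Bot" "Imp a Bot" "Neg a"]
      by (auto simp: v_def)
    ultimately have "proper_filter v" unfolding proper_filter_def by blast
    from max[OF this uv] have "v = u" .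
    moreover have "Imp a a \<in> u" by (rule proper_filterD(1)[OF u(1) provable_taut]) simp
    then have "a \<in> v" by (simp add: v_def)
    ultimately show False using a by simp
  qed
  with u show ?thesis by blast
qed

section \<open>Countable languages closed under the needed formulas\<close>

declare prop_eval.simps(3) [simp del]

lemma prop_eval_Conj_family [simp]:
  "prop_eval \<nu> (Conj (family I \<phi>)) \<longleftrightarrow> (\<forall>i\<in>I. prop_eval \<nu> (\<phi> i))"
  unfolding prop_eval_Conj_iff family_def by auto

text \<open>The continuity axiom speaks about total sequences. Filling the gaps of a partial sequence by
  \<open>Top\<close> makes it total and leaves its conjunction unchanged.\<close>

definition padded :: "(nat \<rightharpoonup> 'p fm) \<Rightarrow> nat \<Rightarrow> 'p fm" where
  "padded F i = (case F i of None \<Rightarrow> Top | Some a \<Rightarrow> a)"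

abbreviation initial :: "(nat \<rightharpoonup> 'p fm) \<Rightarrow> nat \<Rightarrow> 'p fm" where
  "initial F k \<equiv> Conj (family {..k} (padded F))"

text \<open>The second conjunct is the conjunction of the padded sequence, not \<open>Conj F\<close>, so that the formula is
  literally the one in the continuity axiom; \<open>prop_eval_defect\<close> says what it means for \<open>F\<close>.\<close>

definition defect :: "(nat \<rightharpoonup> 'p fm) \<Rightarrow> nat \<Rightarrow> 'p fm" where
  "defect F k = And (initial F k) (Neg (Conj (family UNIV (padded F))))"

definition continuity :: "(nat \<rightharpoonup> 'p fm) \<Rightarrow> 'p fm" where
  "continuity F = Conj (family {0<..} (\<lambda>n. Disj (family UNIV (\<lambda>k.
     Neg (Lik (index_of_rat (1 / of_nat n)) (defect F k))))))"

definition arch_conj :: "index \<Rightarrow> 'p fm \<Rightarrow> 'p fm" where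
  "arch_conj r a = conj_set {Lik s a | s. rat_of_index s < rat_of_index r}"

lemma countable_Lik_below: "countable {Lik s a | s. rat_of_index s < rat_of_index r}"
proof -
  have "{Lik s a | s. rat_of_index s < rat_of_index r} \<subseteq> range (\<lambda>s. Lik s a)" by auto
  then show ?thesis by (rule countable_subset) (rule countable_image[OF countable_index])
qed

lemma provable_continuity: "provable (continuity F)"
  unfolding continuity_def defect_def by (rule provable.ax[OF is_axiom.lik_cont])

lemma provable_arch: "provable (Imp (arch_conj r a) (Lik r a))"
  unfolding arch_conj_def conj_set_def
  by (rule provable.ax[OF is_axiom.lik_arch]) (rule ran_enumeration[OF countable_Lik_below])

lemma prop_eval_padded: "(\<forall>i. prop_eval \<nu> (padded F i)) \<longleftrightarrow> prop_eval \<nu> (Conj F)"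
  unfolding prop_eval_Conj_iff padded_def by (auto split: option.splits)

lemma prop_ecanonical_val_defect:
  "prop_eval \<nu> (defect F k) \<longleftrightarrow> prop_eval \<nu> (initial F k) \<and> \<not> prop_eval \<nu> (Conj F)"
  unfolding prop_eval_padded[of \<nu> F, symmetric] defect_def by simp

lemma index_between:
  assumes "0 \<le> x" "x < y" "y \<le> 1"
  shows "\<exists>r. x < real_index r \<and> real_index r < y"
proof -
  obtain q where q: "q \<in> \<rat>" "x < q" "q < y" using Rats_dense_in_real[OF assms(2)] by blast
  then obtain p where p: "q = of_rat p" by (auto elim: Rats_cases)
  have "0 < (of_rat p :: real)" "(of_rat p :: real) < 1" using q assms unfolding p by linarith+
  then have "0 \<le> p" "p \<le> 1" by simp_all
  then show ?thesis using q p rat_of_index_of_rat by metis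
qed

lemma real_index_bounds: "0 \<le> real_index r" "real_index r \<le> 1"
  using rat_of_index[of r] by auto

lemma ran_map_option: "ran (map_option f \<circ> F) = f ` ran F"
  by (auto simp: ran_def)

lemma ran_family: "ran (family I g) = g ` I"
  by (auto simp: ran_def family_def)

text \<open>What the canonical model asks of its language. The formulas \<open>arch_conj r a\<close> make rational suprema
  of likelihood bounds attained, the continuity axioms make the probabilities countably additive,
  and \<open>Conj_Next\<close> lets the successor of a world respect conjunctions. Countability allows the
  conjunctions of the language to be treated one after the other.\<close>

locale closed_language =
  fixes A :: "'p fm set"
  assumes countable_A: "countable A" and nonempty_A: "A \<noteq> {}"
    and Neg_iff: "Neg a \<in> A \<longleftrightarrow> a \<in> A"
    and And_in: "a \<in> A \<Longrightarrow> b \<in> A \<Longrightarrow> And a b \<in> A"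
    and Lik_iff: "Lik r a \<in> A \<longleftrightarrow> a \<in> A"
    and Next_iff: "Next a \<in> A \<longleftrightarrow> a \<in> A"
    and Conj_sub: "Conj F \<in> A \<Longrightarrow> F i = Some a \<Longrightarrow> a \<in> A"
    and Conj_Next: "Conj F \<in> A \<Longrightarrow> Conj (map_option Next \<circ> F) \<in> A"
    and arch_in: "a \<in> A \<Longrightarrow> arch_conj r a \<in> A"
    and continuity_in: "Conj F \<in> A \<Longrightarrow> continuity F \<in> A"
begin

lemma Imp_in: "a \<in> A \<Longrightarrow> b \<in> A \<Longrightarrow> Imp a b \<in> A"
  by (simp add: Imp_def Neg_iff And_in)

lemmas in_simps = Neg_iff And_in Lik_iff Next_iff Imp_in

lemma Conj_ran: "Conj F \<in> A \<Longrightarrow> a \<in> ran F \<Longrightarrow> a \<in> A"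
  using Conj_sub by (auto simp: ran_def)

lemma And_sub: "And a b \<in> A \<Longrightarrow> a \<in> A \<and> b \<in> A"
  unfolding And_def using Conj_sub[of _ 0 a] Conj_sub[of _ 1 b] by auto

lemma Conj_family_sub: "Conj (family I g) \<in> A \<Longrightarrow> i \<in> I \<Longrightarrow> g i \<in> A"
  by (rule Conj_sub[of "family I g" i]) (simp_all add: family_def)

text \<open>Each \<open>defect F k\<close> is a subformula of the continuity axiom, for instance of its conjunct \<open>n = 1\<close>.\<close>

lemma defect_in:
  assumes "Conj F \<in> A" shows "defect F k \<in> A"
proof -
  have "Disj (family UNIV (\<lambda>k. Neg (Lik (index_of_rat (1 / of_nat 1)) (defect F k)))) \<in> A"
    using Conj_family_sub[OF continuity_in[OF assms, unfolded continuity_def], of 1] by simp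
  then have "Conj (map_option Neg \<circ> family UNIV (\<lambda>k. Neg (Lik (index_of_rat (1 / of_nat 1)) (defect F k)))) \<in> A"
    by (simp add: Disj_def Neg_iff)
  from Conj_sub[OF this, of k] show ?thesis by (simp add: family_def in_simps)
qed

lemma initial_in: "Conj F \<in> A \<Longrightarrow> initial F k \<in> A"
  using defect_in[of F k] And_sub[of "initial F k" "Neg (Conj (family UNIV (padded F)))"]
  unfolding defect_def by blast

section \<open>Worlds\<close>

definition world :: "'p fm set \<Rightarrow> bool" where
  "world w \<longleftrightarrow> w \<subseteq> A \<and> (\<forall>a\<in>A. provable a \<longrightarrow> a \<in> w) \<and> (\<forall>a\<in>A. Neg a \<in> w \<longleftrightarrow> a \<notin> w) \<and>
     (\<forall>F. Conj F \<in> A \<longrightarrow> (Conj F \<in> w \<longleftrightarrow> (\<forall>a\<in>ran F. a \<in> w)))"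

lemma world_sub: "world w \<Longrightarrow> a \<in> w \<Longrightarrow> a \<in> A"
  and world_provable: "world w \<Longrightarrow> provable a \<Longrightarrow> a \<in> A \<Longrightarrow> a \<in> w"
  and world_Neg: "world w \<Longrightarrow> a \<in> A \<Longrightarrow> Neg a \<in> w \<longleftrightarrow> a \<notin> w"
  and world_Conj: "world w \<Longrightarrow> Conj F \<in> A \<Longrightarrow> Conj F \<in> w \<longleftrightarrow> (\<forall>a\<in>ran F. a \<in> w)"
  unfolding world_def by blast+

lemma world_And:
  assumes "world w" "a \<in> A" "b \<in> A"
  shows "And a b \<in> w \<longleftrightarrow> a \<in> w \<and> b \<in> w"
proof -
  have "ran [0::nat \<mapsto> a, 1 \<mapsto> b] = {a, b}" by (auto simp: ran_map_upd)
  then show ?thesis using world_Conj[OF assms(1), of "[0 \<mapsto> a, 1 \<mapsto> b]"] And_in[OF assms(2,3)]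
    by (simp add: And_def)
qed

lemma world_Imp: "world w \<Longrightarrow> a \<in> A \<Longrightarrow> b \<in> A \<Longrightarrow> Imp a b \<in> w \<longleftrightarrow> (a \<in> w \<longrightarrow> b \<in> w)"
  by (simp add: Imp_def world_Neg world_And in_simps)

lemma world_conseq: "world w \<Longrightarrow> provable (Imp a b) \<Longrightarrow> a \<in> w \<Longrightarrow> b \<in> A \<Longrightarrow> b \<in> w"
  using world_Imp[of w a b] world_provable[of w "Imp a b"] world_sub[of w a] Imp_in[of a b] by blast

lemma world_Disj:
  assumes w: "world w" and D: "Disj F \<in> A"
  shows "Disj F \<in> w \<longleftrightarrow> (\<exists>a\<in>ran F. a \<in> w)"
proof -
  have C: "Conj (map_option Neg \<circ> F) \<in> A" using D by (simp add: Disj_def Neg_iff)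
  then have "a \<in> A" if "a \<in> ran F" for a
    using that Conj_ran[OF C, of "Neg a"] by (simp add: ran_map_option Neg_iff)
  then show ?thesis
    using world_Neg[OF w] world_Conj[OF w C] C by (auto simp: Disj_def ran_map_option)
qed

text \<open>The formulas implied by some \<open>D n\<close> form a proper filter. An ultrafilter extending it need not respect
  infinite conjunctions, but by the third assumption it contains \<open>Conj F\<close> as soon as it contains
  one particular finite part of it.\<close>

lemma world_from_chain:
  assumes cons: "\<And>n. \<not> provable (Neg (D n))"
    and dec: "\<And>n. provable (Imp (D (Suc n)) (D n))"
    and omit: "\<And>F. Conj F \<in> A \<Longrightarrow> \<exists>n k. provable (Imp (And (D n) (initial F k)) (Conj F))"
  shows "\<exists>w. world w \<and> (\<forall>n a. a \<in> A \<longrightarrow> provable (Imp (D n) a) \<longrightarrow> a \<in> w)"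
proof -
  have mono: "provable (Imp (D (n + k)) (D n))" for n k
  proof (induction k)
    case (Suc k)
    show ?case by (rule provable_conseq2[OF dec[of "n + k"] Suc]) simp
  qed (auto intro: provable_taut)
  define \<Phi> where "\<Phi> = {b. \<exists>n. provable (Imp (D n) b)}"
  have "proper_filter \<Phi>"
    unfolding proper_filter_def
  proof (intro conjI allI impI)
    show "a \<in> \<Phi>" if "provable a" for a
    proof -
      have "provable (Imp (D 0) a)" by (rule provable_conseq1[OF that]) simp
      then show ?thesis by (auto simp: \<Phi>_def)
    qed
    show "b \<in> \<Phi>" if ab: "a \<in> \<Phi>" "Imp a b \<in> \<Phi>" for a b
    proof -
      obtain n m where a: "provable (Imp (D n) a)" and ab: "provable (Imp (D m) (Imp a b))"
        using ab by (auto simp: \<Phi>_def)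
      have "provable (Imp (D (n + m)) a)" by (rule provable_conseq2[OF a mono[of n m]]) simp
      moreover have "provable (Imp (D (n + m)) (Imp a b))"
        using mono[of m n] by (intro provable_conseq2[OF ab mono[of m n]]) (simp add: add.commute)
      ultimately have "provable (Imp (D (n + m)) b)" by (rule provable_conseq2) simp
      then show ?thesis by (auto simp: \<Phi>_def)
    qed
    have "provable (Neg (D n))" if "provable (Imp (D n) Bot)" for n
      by (rule provable_conseq1[OF that]) simp
    then show "Bot \<notin> \<Phi>" using cons by (auto simp: \<Phi>_def)
  qed
  then obtain u where u: "proper_filter u" "\<Phi> \<subseteq> u" and ult: "\<And>a. a \<in> u \<or> Neg a \<in> u"
    using ultrafilter_exists by blast
  note conseq = proper_filter_conseq[OF u(1)]
  have neg: "Neg a \<in> u \<longleftrightarrow> a \<notin> u" for a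
    using ult[of a] conseq[of a "Neg a" Bot] proper_filterD(3)[OF u(1)] by auto
  have D: "a \<in> u" if "provable (Imp (D n) a)" for n a
    using that u(2) by (auto simp: \<Phi>_def)
  have Conj: "Conj F \<in> u \<longleftrightarrow> (\<forall>a\<in>ran F. a \<in> u)" if F: "Conj F \<in> A" for F
  proof
    assume C: "Conj F \<in> u"
    show "\<forall>a\<in>ran F. a \<in> u"
    proof
      fix a assume "a \<in> ran F"
      then show "a \<in> u" by (intro conseq[OF C C]) (auto simp: ran_def prop_eval_Conj_iff)
    qed
  next
    assume all: "\<forall>a\<in>ran F. a \<in> u"
    have t: "padded F i \<in> u" for i
    proof (cases "F i")
      case None
      have "Top \<in> u" by (rule proper_filterD(1)[OF u(1) provable_taut]) simp
      then show ?thesis using None by (simp add: padded_def)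
    next
      case (Some a)
      then show ?thesis using all by (auto simp: padded_def ran_def)
    qed
    have ini: "initial F k \<in> u" for k
    proof (induction k)
      case 0
      show ?case by (rule conseq[OF t[of 0] t[of 0]]) simp
    next
      case (Suc k)
      show ?case by (rule conseq[OF Suc t[of "Suc k"]]) (auto simp: le_Suc_eq)
    qed
    obtain n k where nk: "provable (Imp (And (D n) (initial F k)) (Conj F))" using omit[OF F] by blast
    have "provable (Imp (D n) (Imp (initial F k) (Conj F)))"
      by (rule provable_conseq1[OF nk]) simp
    then show "Conj F \<in> u" using D proper_filterD(2)[OF u(1)] ini by blast
  qed
  have "world (u \<inter> A)"
    unfolding world_def
    using proper_filterD(1)[OF u(1)] neg Conj Conj_sub
    by (auto simp: Neg_iff) (auto simp: ran_def)
  then show ?thesis using D by blast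
qed

text \<open>A Henkin construction. For each conjunction in turn, a consistent \<open>x\<close> stays consistent after adding
  either the conjunction or the negation of one of its members: if \<open>x\<close> refuted the conjunction and
  implied all of its members, it would imply the conjunction too, by the infinitary rule. Both
  additions reduce the conjunction to a finite part, as \<open>world_from_chain\<close> demands.\<close>

lemma world_exists:
  assumes a: "a \<in> A" "\<not> provable (Neg a)"
  shows "\<exists>w. world w \<and> a \<in> w"
proof -
  define P :: "nat \<Rightarrow> 'p fm \<Rightarrow> bool" where
    "P n x \<longleftrightarrow> \<not> provable (Neg x) \<and> (n = 0 \<longrightarrow> x = a)" for n x
  define Q where "Q n x y \<longleftrightarrow> provable (Imp y x) \<and>
    (\<forall>F. from_nat_into A n = Conj F \<longrightarrow> (\<exists>k. provable (Imp (And y (initial F k)) (Conj F))))" for n x y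
  have "\<exists>y. P (Suc n) y \<and> Q n x y" if x: "P n x" for n x
  proof (cases "\<exists>F. from_nat_into A n = Conj F")
    case False
    then show ?thesis using x by (intro exI[of _ x]) (auto simp: P_def Q_def intro: provable_taut)
  next
    case True
    then obtain F where F: "from_nat_into A n = Conj F" by blast
    show ?thesis
    proof (cases "provable (Neg (And x (Conj F)))")
      case False
      have "provable (Imp (And (And x (Conj F)) (initial F 0)) (Conj F))"
        "provable (Imp (And x (Conj F)) x)" by (rule provable_taut, simp)+
      then have "\<exists>k. provable (Imp (And (And x (Conj F)) (initial F k)) (Conj F))"
        "provable (Imp (And x (Conj F)) x)" by blast+
      then show ?thesis using F False
        by (intro exI[of _ "And x (Conj F)"]) (simp add: P_def Q_def)
    next
      case True
      have "\<exists>i c. F i = Some c \<and> \<not> provable (Neg (And x (Neg c)))"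
      proof (rule ccontr)
        assume none: "\<not> ?thesis"
        have "provable (Imp x (Conj F))"
        proof (rule provable_conj)
          fix c assume "c \<in> ran F"
          then have "provable (Neg (And x (Neg c)))" using none by (auto simp: ran_def)
          then show "provable (Imp x c)" by (rule provable_conseq1) simp
        qed
        then have "provable (Neg x)" by (rule provable_conseq2[OF True]) simp
        then show False using x by (simp add: P_def)
      qed
      then obtain i c where ic: "F i = Some c" "\<not> provable (Neg (And x (Neg c)))" by blast
      have "padded F i = c" using ic by (simp add: padded_def)
      then have "provable (Imp (And (And x (Neg c)) (initial F i)) (Conj F))"
        by (intro provable_taut) auto
      moreover have "provable (Imp (And x (Neg c)) x)" by (rule provable_taut) simp
      ultimately show ?thesis using F ic by (intro exI[of _ "And x (Neg c)"]) (auto simp: P_def Q_def)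
    qed
  qed
  moreover have "\<exists>x. P 0 x" using a by (auto simp: P_def)
  ultimately obtain D where "\<forall>n. P n (D n) \<and> Q n (D n) (D (Suc n))"
    using dependent_nat_choice[of P Q] by blast
  then have P: "P n (D n)" and Q: "Q n (D n) (D (Suc n))" for n by auto
  have D0: "D 0 = a" using P[of 0] by (simp add: P_def)
  have "\<exists>w. world w \<and> (\<forall>n a. a \<in> A \<longrightarrow> provable (Imp (D n) a) \<longrightarrow> a \<in> w)"
  proof (rule world_from_chain)
    show "\<not> provable (Neg (D n))" for n using P by (simp add: P_def)
    show "provable (Imp (D (Suc n)) (D n))" for n using Q by (simp add: Q_def)
    fix F assume F: "Conj F \<in> A"
    then have "from_nat_into A (to_nat_on A (Conj F)) = Conj F"
      by (simp add: countable_A)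
    then show "\<exists>n k. provable (Imp (And (D n) (initial F k)) (Conj F))"
      using Q unfolding Q_def by blast
  qed
  moreover have "provable (Imp (D 0) a)" by (rule provable_taut) (simp add: D0)
  ultimately show ?thesis using a by blast
qed

section \<open>The probability of a formula at a world\<close>

lemma world_conj_set:
  assumes "world w" "countable X" "conj_set X \<in> A"
  shows "conj_set X \<in> w \<longleftrightarrow> (\<forall>a\<in>X. a \<in> w)"
  using world_Conj[OF assms(1,3)[unfolded conj_set_def]]
  unfolding conj_set_def ran_enumeration[OF assms(2)] .

definition wprob :: "'p fm set \<Rightarrow> 'p fm \<Rightarrow> real" where
  "wprob w a = (SUP r\<in>{r. Lik r a \<in> w}. real_index r)"

context
  fixes w assumes w: "world w"
begin

lemma bdd_real_index: "bdd_above (real_index ` R)"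
  by (rule bdd_aboveI2[of _ _ 1]) (rule real_index_bounds)

lemma Lik_zero_in: "a \<in> A \<Longrightarrow> Lik (index_of_rat 0) a \<in> w"
  by (rule world_provable[OF w provable_Lik_zero]) (simp_all add: rat_of_index_of_rat in_simps)

lemma less_wprob_iff: "a \<in> A \<Longrightarrow> x < wprob w a \<longleftrightarrow> (\<exists>r. Lik r a \<in> w \<and> x < real_index r)"
  unfolding wprob_def using Lik_zero_in[of a]
  by (subst less_cSUP_iff) (auto simp: bdd_real_index)

lemma le_wprob: "Lik r a \<in> w \<Longrightarrow> real_index r \<le> wprob w a"
  unfolding wprob_def by (rule cSUP_upper) (auto simp: bdd_real_index)

text \<open>A rational supremum is attained: if all \<open>Lik s a\<close> with \<open>s < r\<close> are in \<open>w\<close>, then so is their conjunction, and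
  the Archimedean axiom applies. This is why the conjunction has to belong to the language.\<close>

lemma Lik_in_world_iff:
  assumes a: "a \<in> A"
  shows "Lik r a \<in> w \<longleftrightarrow> real_index r \<le> wprob w a"
proof (rule iffI[OF le_wprob])
  assume le: "real_index r \<le> wprob w a"
  have "Lik s a \<in> w" if s: "rat_of_index s < rat_of_index r" for s
  proof -
    have "real_index s < real_index r" using s by (simp add: of_rat_less)
    then have "real_index s < wprob w a" using le by simp
    then obtain t where t: "Lik t a \<in> w" "real_index s < real_index t" using less_wprob_iff[OF a] by blast
    then have "rat_of_index s \<le> rat_of_index t" by (simp add: of_rat_less)
    from world_conseq[OF w provable_Lik_antimono[OF this] t(1)] show ?thesis
      by (simp add: a in_simps)
  qed
  moreover have "arch_conj r a \<in> w \<longleftrightarrow> (\<forall>b\<in>{Lik s a | s. rat_of_index s < rat_of_index r}. b \<in> w)"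
    unfolding arch_conj_def
    by (rule world_conj_set[OF w countable_Lik_below arch_in[OF a, of r, unfolded arch_conj_def]])
  ultimately have "arch_conj r a \<in> w" by blast
  from world_conseq[OF w provable_arch this] show "Lik r a \<in> w" by (simp add: a in_simps)
qed

lemma wprob_nonneg: "a \<in> A \<Longrightarrow> 0 \<le> wprob w a"
  using le_wprob[OF Lik_zero_in[of a]] by (simp add: rat_of_index_of_rat)

lemma wprob_le_1: "a \<in> A \<Longrightarrow> wprob w a \<le> 1"
  unfolding wprob_def using Lik_zero_in[of a] by (intro cSUP_least real_index_bounds) auto

lemma wprob_provable: "provable a \<Longrightarrow> a \<in> A \<Longrightarrow> wprob w a = 1"
  using le_wprob[OF world_provable[OF w provable_nec], of a] wprob_le_1[of a]
  by (simp add: rat_of_index_of_rat in_simps)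

lemma wprob_mono:
  assumes ab: "provable (Imp a b)" and in_A: "a \<in> A" "b \<in> A"
  shows "wprob w a \<le> wprob w b"
proof (rule ccontr)
  assume "\<not> ?thesis"
  then have "wprob w b < wprob w a" by simp
  then obtain r where r: "Lik r a \<in> w" "wprob w b < real_index r" using less_wprob_iff[OF in_A(1)] by blast
  have "Lik r b \<in> w"
    by (rule world_conseq[OF w provable_Lik_mono[OF ab] r(1)]) (simp add: in_A in_simps)
  then show False using le_wprob[of r b] r(2) by simp
qed

lemma wprob_refuted:
  assumes a: "provable (Neg a)" and in_A: "a \<in> A"
  shows "wprob w a = 0"
proof (rule ccontr)
  assume "wprob w a \<noteq> 0"
  then have "0 < wprob w a" using wprob_nonneg[OF in_A] by simp
  then obtain r where r: "Lik r a \<in> w" "0 < real_index r" using less_wprob_iff[OF in_A] by blast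
  have "provable (Neg (Lik r a))" by (rule provable_not_Lik[OF a]) (use r(2) in simp)
  then have "Neg (Lik r a) \<in> w" by (rule world_provable[OF w]) (simp add: in_A in_simps)
  then show False using r(1) world_Neg[OF w, of "Lik r a"] by (simp add: in_A in_simps)
qed

lemma index_sum:
  assumes "rat_of_index r + rat_of_index s \<le> 1"
  obtains t where "rat_of_index t = rat_of_index r + rat_of_index s" "real_index t = real_index r + real_index s"
proof -
  have "0 \<le> rat_of_index r + rat_of_index s" using rat_of_index[of r] rat_of_index[of s] by simp
  then have "rat_of_index (index_of_rat (rat_of_index r + rat_of_index s)) = rat_of_index r + rat_of_index s"
    using assms by (rule rat_of_index_of_rat)
  then show thesis using that by (metis of_rat_add)
qed

text \<open>Otherwise there are rational strict upper bounds of the two parts whose sum is still below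
  the probability of \<open>a\<close>; this contradicts the axiom \<open>lik_subadd\<close>.\<close>

lemma wprob_subadd:
  assumes in_A: "a \<in> A" "b \<in> A"
  shows "wprob w a \<le> wprob w (And a b) + wprob w (And a (Neg b))"
proof (rule ccontr)
  let ?x = "wprob w (And a b)" and ?y = "wprob w (And a (Neg b))" and ?z = "wprob w a"
  assume "\<not> ?thesis"
  then have less: "?x + ?y < ?z" by simp
  have bds: "0 \<le> ?x" "0 \<le> ?y" "?z \<le> 1"
    using in_A by (auto intro!: wprob_nonneg wprob_le_1 simp: in_simps)
  define d where "d = (?z - ?x - ?y) / 2"
  have d: "0 < d" "?x + ?y + 2 * d = ?z" using less by (simp_all add: d_def field_simps)
  obtain r where r: "?x < real_index r" "real_index r < ?x + d" using index_between[of ?x "?x + d"] d bds by force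
  obtain s where s: "?y < real_index s" "real_index s < ?y + d" using index_between[of ?y "?y + d"] d bds by force
  have "real_index r + real_index s < 1" using r s d bds by simp
  then have "of_rat (rat_of_index r + rat_of_index s) < (1 :: real)" by (simp add: of_rat_add)
  then have "rat_of_index r + rat_of_index s \<le> 1" by simp
  then obtain t where t: "rat_of_index t = rat_of_index r + rat_of_index s" "real_index t = real_index r + real_index s"
    by (rule index_sum)
  have "Lik r (And a b) \<notin> w" "Lik s (And a (Neg b)) \<notin> w"
    using le_wprob r(1) s(1) by (meson not_le)+
  moreover have "Imp (And (Neg (Lik r (And a b))) (Neg (Lik s (And a (Neg b))))) (Neg (Lik t a)) \<in> w"
    by (rule world_provable[OF w provable.ax[OF is_axiom.lik_subadd[OF t(1)]]])
      (simp add: in_A in_simps)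
  ultimately have "Lik t a \<notin> w"
    by (simp add: world_Imp[OF w] world_And[OF w] world_Neg[OF w] in_A in_simps)
  then have "?z < real_index t" using Lik_in_world_iff[OF in_A(1)] by simp
  then show False using t(2) r s d by simp
qed

text \<open>Rational lower bounds \<open>r\<close> and \<open>s\<close> of the two parts can be added by the axiom \<open>lik_add\<close>, provided that
  \<open>r + s\<close> is an index. If it exceeded 1, then \<open>Lik s (Neg b)\<close> and \<open>Lik r b\<close> would both be in \<open>w\<close>, contrary
  to the axiom \<open>lik_neg\<close>.\<close>

lemma wprob_superadd:
  assumes in_A: "a \<in> A" "b \<in> A"
  shows "wprob w (And a b) + wprob w (And a (Neg b)) \<le> wprob w a"
proof (rule ccontr)
  let ?x = "wprob w (And a b)" and ?y = "wprob w (And a (Neg b))" and ?z = "wprob w a"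
  assume "\<not> ?thesis"
  then have less: "?z < ?x + ?y" by simp
  have xz: "?x \<le> ?z" and yz: "?y \<le> ?z"
    by (auto intro!: wprob_mono provable_taut simp: in_A in_simps)
  obtain r where r: "Lik r (And a b) \<in> w" "?z - ?y < real_index r"
    using less_wprob_iff[of "And a b" "?z - ?y"] less in_A by (auto simp: in_simps)
  obtain s where s: "Lik s (And a (Neg b)) \<in> w" "?z - real_index r < real_index s"
    using less_wprob_iff[of "And a (Neg b)" "?z - real_index r"] r in_A by (auto simp: in_simps)
  have "rat_of_index r + rat_of_index s \<le> 1"
  proof (rule ccontr)
    assume gt: "\<not> ?thesis"
    have "provable (Imp (And a b) b)" "provable (Imp (And a (Neg b)) (Neg b))"
      by (rule provable_taut, simp)+
    then have "Lik r b \<in> w" "Lik s (Neg b) \<in> w"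
      using world_conseq[OF w provable_Lik_mono r(1)] world_conseq[OF w provable_Lik_mono s(1)]
      by (simp_all add: in_A in_simps)
    moreover have "Imp (Lik s (Neg b)) (Neg (Lik r b)) \<in> w"
      by (rule world_provable[OF w provable.ax[OF is_axiom.lik_neg]])
        (use gt in \<open>simp_all add: in_A in_simps\<close>)
    ultimately show False by (simp add: world_Imp[OF w] world_Neg[OF w] in_A in_simps)
  qed
  then obtain t where t: "rat_of_index t = rat_of_index r + rat_of_index s" "real_index t = real_index r + real_index s"
    by (rule index_sum)
  have "Imp (And (Lik r (And a b)) (Lik s (And a (Neg b)))) (Lik t a) \<in> w"
    by (rule world_provable[OF w provable.ax[OF is_axiom.lik_add[OF t(1)]]])
      (simp add: in_A in_simps)
  then have "Lik t a \<in> w"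
    using r(1) s(1) by (simp add: world_Imp[OF w] world_And[OF w] in_A in_simps)
  from le_wprob[OF this] show False using t(2) s(2) by simp
qed

lemma wprob_add:
  "a \<in> A \<Longrightarrow> b \<in> A \<Longrightarrow> wprob w a = wprob w (And a b) + wprob w (And a (Neg b))"
  by (intro antisym wprob_subadd wprob_superadd)

text \<open>This is the continuity axiom, read at the world \<open>w\<close>.\<close>

lemma wprob_defect_small:
  assumes F: "Conj F \<in> A" and e: "0 < e"
  shows "\<exists>k. wprob w (defect F k) < e"
proof -
  obtain n where n: "0 < n" "1 / real n < e" using e nat_approx_posE[of e] by (metis zero_less_Suc)
  let ?r = "index_of_rat (1 / of_nat n)"
  let ?D = "Disj (family UNIV (\<lambda>k. Neg (Lik ?r (defect F k))))"
  have "continuity F \<in> w"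
    by (rule world_provable[OF w provable_continuity continuity_in[OF F]])
  then have D: "?D \<in> w"
    using world_Conj[OF w continuity_in[OF F, unfolded continuity_def]] n(1)
    unfolding continuity_def by (auto simp: ran_family)
  then obtain k where "Neg (Lik ?r (defect F k)) \<in> w"
    using world_Disj[OF w world_sub[OF w D]] by (auto simp: ran_family)
  then have "Lik ?r (defect F k) \<notin> w"
    using world_Neg[OF w] defect_in[OF F, of k] by (simp add: in_simps)
  then have "wprob w (defect F k) < real_index ?r"
    using Lik_in_world_iff[OF defect_in[OF F]] by simp
  also have "real_index ?r = 1 / real n"
    using n(1) by (subst rat_of_index_of_rat) (auto simp: of_rat_divide)
  finally show ?thesis using n(2) by (intro exI[of _ k]) simp
qed

text \<open>The compactness property behind countable additivity. For the \<open>n\<close>-th formula of the language, if it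
  is a conjunction, let \<open>c n\<close> be a defect of probability below \<open>e / 2 ^ (n + 2)\<close>. A world that contains
  all \<open>b n\<close> and no \<open>c n\<close> is found by \<open>world_from_chain\<close>, as \<open>b n\<close> without the first \<open>n\<close> defects has
  probability at least \<open>e / 2 + e / 2 ^ (n + 1)\<close> and is therefore consistent.\<close>

lemma world_of_large_chain:
  assumes in_A: "\<And>n. b n \<in> A"
    and dec: "\<And>n. provable (Imp (b (Suc n)) (b n))"
    and e: "0 < e" "\<And>n. e \<le> wprob w (b n)"
  shows "\<exists>v. world v \<and> (\<forall>n. b n \<in> v)"
proof -
  have "\<exists>c\<in>A. wprob w c < e / 2 ^ (n + 2) \<and>
      (\<forall>F. from_nat_into A n = Conj F \<longrightarrow> (\<exists>k. c = defect F k))" for n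
  proof (cases "\<exists>F. from_nat_into A n = Conj F")
    case True
    then obtain F where F: "from_nat_into A n = Conj F" by blast
    then have FA: "Conj F \<in> A" using from_nat_into[OF nonempty_A, of n] by simp
    obtain k where "wprob w (defect F k) < e / 2 ^ (n + 2)"
      using wprob_defect_small[OF FA, of "e / 2 ^ (n + 2)"] e(1) by auto
    then show ?thesis using F defect_in[OF FA, of k] by auto
  next
    case False
    \<comment> \<open>Nothing has to be excluded; any formula of probability 0 will do.\<close>
    have "wprob w (And (b 0) (Neg (b 0))) = 0"
      by (rule wprob_refuted) (auto intro: provable_taut simp: in_A in_simps)
    moreover have "And (b 0) (Neg (b 0)) \<in> A" using in_A by (simp add: in_simps)
    ultimately show ?thesis using False e(1) by (intro bexI[of _ "And (b 0) (Neg (b 0))"]) auto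
  qed
  then obtain c where c: "\<And>n. c n \<in> A" "\<And>n. wprob w (c n) < e / 2 ^ (n + 2)"
      "\<And>n F. from_nat_into A n = Conj F \<Longrightarrow> \<exists>k. c n = defect F k"
    by metis
  \<comment> \<open>Every \<open>b k\<close> implies \<open>E 0 = b 0\<close>, so conjoining \<open>E 0\<close> leaves its probability at least \<open>e\<close>.\<close>
  define E where "E = rec_nat (b 0) (\<lambda>n x. And x (Neg (c n)))"
  have E: "E 0 = b 0" "E (Suc n) = And (E n) (Neg (c n))" for n by (simp_all add: E_def)
  have E_in: "E n \<in> A" for n by (induction n) (simp_all add: E in_A c(1) in_simps)
  have b0: "provable (Imp (b k) (b 0))" for k
  proof (induction k)
    case (Suc k)
    show ?case by (rule provable_conseq2[OF dec[of k] Suc]) simp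
  qed (auto intro: provable_taut)
  have large: "e / 2 + e / 2 ^ (n + 1) \<le> wprob w (And (b k) (E n))" for k n
  proof (induction n)
    case 0
    have "provable (Imp (b k) (And (b k) (E 0)))" by (rule provable_conseq1[OF b0[of k]]) (simp add: E)
    from wprob_mono[OF this] show ?case using e(2)[of k] in_A by (simp add: E in_simps)
  next
    case (Suc n)
    let ?a = "And (b k) (E n)"
    have "wprob w ?a = wprob w (And ?a (c n)) + wprob w (And ?a (Neg (c n)))"
      by (rule wprob_add) (simp_all add: in_A E_in c(1) in_simps)
    moreover have "wprob w (And ?a (c n)) \<le> wprob w (c n)"
      "wprob w (And ?a (Neg (c n))) \<le> wprob w (And (b k) (E (Suc n)))"
      by (auto intro!: wprob_mono provable_taut simp: in_A E_in E c(1) in_simps)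
    moreover have "e / 2 ^ (n + 1) = e / 2 ^ (n + 2) + e / 2 ^ (Suc n + 1)" by simp
    ultimately show ?case using Suc c(2)[of n] by linarith
  qed
  have "\<exists>v. world v \<and> (\<forall>n a. a \<in> A \<longrightarrow> provable (Imp (And (b n) (E n)) a) \<longrightarrow> a \<in> v)"
  proof (rule world_from_chain)
    show "\<not> provable (Neg (And (b n) (E n)))" for n
    proof
      assume "provable (Neg (And (b n) (E n)))"
      then have "wprob w (And (b n) (E n)) = 0" by (rule wprob_refuted) (simp add: in_A E_in in_simps)
      moreover have "0 < e / 2 + e / 2 ^ (n + 1)" using e(1) by (simp add: add_pos_pos)
      ultimately show False using large[of n n] by simp
    qed
    show "provable (Imp (And (b (Suc n)) (E (Suc n))) (And (b n) (E n)))" for n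
      by (rule provable_conseq1[OF dec[of n]]) (simp add: E)
    fix F assume F: "Conj F \<in> A"
    define n where "n = to_nat_on A (Conj F)"
    have "from_nat_into A n = Conj F" using F by (simp add: n_def countable_A)
    then obtain k where k: "c n = defect F k" using c(3) by blast
    have "provable (Imp (And (And (b (Suc n)) (E (Suc n))) (initial F k)) (Conj F))"
      by (rule provable_taut) (auto simp: E k prop_ecanonical_val_defect)
    then show "\<exists>n k. provable (Imp (And (And (b n) (E n)) (initial F k)) (Conj F))" by blast
  qed
  moreover have "provable (Imp (And (b n) (E n)) (b n))" for n by (rule provable_taut) simp
  ultimately show ?thesis using in_A by blast
qed

end

section \<open>The canonical model\<close>

definition worlds :: "'p fm set set" where "worlds = {w. world w}"

definition truth_set :: "'p fm \<Rightarrow> 'p fm set set" where "truth_set a = {w \<in> worlds. a \<in> w}"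

lemma truth_set_sub: "truth_set a \<subseteq> worlds"
  by (auto simp: truth_set_def)

lemma truth_set_subset_Pow: "truth_set ` A \<subseteq> Pow worlds"
  using truth_set_sub by blast

lemma truth_set_And: "a \<in> A \<Longrightarrow> b \<in> A \<Longrightarrow> truth_set (And a b) = truth_set a \<inter> truth_set b"
  by (auto simp: truth_set_def worlds_def world_And)

lemma truth_set_Neg: "a \<in> A \<Longrightarrow> truth_set (Neg a) = worlds - truth_set a"
  by (auto simp: truth_set_def worlds_def world_Neg)

lemma truth_set_Imp_self: "a \<in> A \<Longrightarrow> truth_set (Imp a a) = worlds"
  by (auto simp: truth_set_def worlds_def world_Imp)

lemma algebra_truth_set: "algebra worlds (truth_set ` A)"
  unfolding algebra_iff_Int
proof (intro conjI ballI)
  obtain a where a: "a \<in> A" using nonempty_A by blast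
  have "truth_set (Neg (Imp a a)) = {}" using a by (simp add: truth_set_Neg truth_set_Imp_self in_simps)
  then show "{} \<in> truth_set ` A" using a by (metis Imp_in Neg_iff imageI)
  show "truth_set ` A \<subseteq> Pow worlds" using truth_set_sub by blast
  show "worlds - X \<in> truth_set ` A" if "X \<in> truth_set ` A" for X
    using that by (auto simp: truth_set_Neg[symmetric] Neg_iff)
  show "X \<inter> Y \<in> truth_set ` A" if "X \<in> truth_set ` A" "Y \<in> truth_set ` A" for X Y
    using that by (auto simp: truth_set_And[symmetric] And_in)
qed

context
  fixes w assumes w: "world w"
begin

text \<open>The case of a constant chain: a formula of positive probability is in some world.\<close>

lemma wprob_truth_set_empty:
  assumes a: "a \<in> A" "truth_set a = {}"
  shows "wprob w a = 0"
proof (rule ccontr)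
  assume "wprob w a \<noteq> 0"
  then have "0 < wprob w a" using wprob_nonneg[OF w a(1)] by simp
  then have "\<exists>v. world v \<and> (\<forall>n::nat. a \<in> v)"
    by (intro world_of_large_chain[OF w, of "\<lambda>_. a" "wprob w a"]) (auto intro: provable_taut a)
  then show False using a(2) by (auto simp: truth_set_def worlds_def)
qed

lemma wprob_truth_set_mono:
  assumes in_A: "a \<in> A" "b \<in> A" and sub: "truth_set a \<subseteq> truth_set b"
  shows "wprob w a \<le> wprob w b"
proof -
  have "wprob w (And a (Neg b)) = 0"
    by (rule wprob_truth_set_empty) (use in_A sub in \<open>auto simp: truth_set_And truth_set_Neg in_simps\<close>)
  moreover have "wprob w (And a b) \<le> wprob w b"
    by (rule wprob_mono[OF w provable_taut]) (simp_all add: in_A in_simps)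
  ultimately show ?thesis using wprob_add[OF w in_A] by simp
qed

lemma wprob_truth_set_cong: "a \<in> A \<Longrightarrow> b \<in> A \<Longrightarrow> truth_set a = truth_set b \<Longrightarrow> wprob w a = wprob w b"
  by (intro antisym wprob_truth_set_mono) auto

text \<open>By \<open>wprob_truth_set_cong\<close> the value does not depend on the formula chosen to represent the set.\<close>

definition premeasure :: "'p fm set set \<Rightarrow> ennreal" where
  "premeasure X = ennreal (wprob w (SOME a. a \<in> A \<and> truth_set a = X))"

lemma premeasure_truth_set:
  assumes a: "a \<in> A" shows "premeasure (truth_set a) = ennreal (wprob w a)"
proof -
  define b where "b = (SOME b. b \<in> A \<and> truth_set b = truth_set a)"
  have "b \<in> A \<and> truth_set b = truth_set a" unfolding b_def by (rule someI[of _ a]) (simp add: a)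
  then have "wprob w b = wprob w a" using wprob_truth_set_cong a by blast
  then show ?thesis by (simp add: premeasure_def b_def)
qed

lemma premeasure_empty: "premeasure {} = 0"
proof -
  obtain a where a: "a \<in> A" "truth_set a = {}" using algebra_truth_set unfolding algebra_iff_Int by (metis imageE)
  then show ?thesis using premeasure_truth_set[OF a(1)] wprob_truth_set_empty[OF a] by simp
qed

lemma premeasure_additive: "additive (truth_set ` A) premeasure"
  unfolding additive_def
proof (intro ballI impI)
  fix X Y assume "X \<in> truth_set ` A" "Y \<in> truth_set ` A" and disj: "X \<inter> Y = {}"
  then obtain a b where ab: "a \<in> A" "X = truth_set a" "b \<in> A" "Y = truth_set b" by blast
  define c where "c = Neg (And (Neg a) (Neg b))"
  have c: "c \<in> A" using ab by (simp add: c_def in_simps)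
  have truth_set_c: "truth_set c = X \<union> Y" using ab truth_set_sub by (auto simp: c_def truth_set_Neg truth_set_And in_simps)
  have "wprob w c = wprob w (And c a) + wprob w (And c (Neg a))"
    by (rule wprob_add[OF w c ab(1)])
  also have "wprob w (And c a) = wprob w a"
    by (rule wprob_truth_set_cong) (use ab c truth_set_c in \<open>auto simp: truth_set_And in_simps\<close>)
  also have "wprob w (And c (Neg a)) = wprob w b"
    by (rule wprob_truth_set_cong)
      (use ab c truth_set_c disj truth_set_sub in \<open>auto simp: truth_set_And truth_set_Neg in_simps\<close>)
  finally have sum: "wprob w c = wprob w a + wprob w b" .
  have "premeasure (X \<union> Y) = ennreal (wprob w c)" using premeasure_truth_set[OF c] truth_set_c by simp
  then show "premeasure (X \<union> Y) = premeasure X + premeasure Y"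
    using ab wprob_nonneg[OF w] by (simp add: sum premeasure_truth_set)
qed

text \<open>The sets are truth sets of a provably decreasing sequence of conjunctions. If their probabilities
  stayed above some \<open>e > 0\<close>, a common world would exist by \<open>world_of_large_chain\<close>.\<close>

lemma premeasure_continuous:
  assumes X: "range X \<subseteq> truth_set ` A" "decseq X" "(\<Inter>i. X i) = {}"
  shows "(\<lambda>i. premeasure (X i)) \<longlonglongrightarrow> 0"
proof -
  have "\<forall>i. \<exists>a. a \<in> A \<and> X i = truth_set a" using X(1) by blast
  then obtain a where a: "\<And>i. a i \<in> A" "\<And>i. X i = truth_set (a i)" by metis
  define b where "b = rec_nat (a 0) (\<lambda>n x. And x (a (Suc n)))"
  have b: "b 0 = a 0" "b (Suc n) = And (b n) (a (Suc n))" for n by (simp_all add: b_def)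
  have b_in: "b n \<in> A" for n by (induction n) (simp_all add: b a in_simps)
  have truth_set_b: "truth_set (b n) = X n" for n
  proof (induction n)
    case (Suc n)
    have "X (Suc n) \<subseteq> X n" using X(2) by (simp add: decseq_Suc_iff)
    then show ?case using Suc by (auto simp: b truth_set_And b_in a)
  qed (simp add: b a)
  have dec: "provable (Imp (b (Suc n)) (b n))" for n by (rule provable_taut) (simp add: b)
  have mono: "wprob w (b m) \<le> wprob w (b n)" if "n \<le> m" for m n
    using b_in X(2) that by (intro wprob_truth_set_mono) (auto simp: truth_set_b decseq_def)
  have "(\<lambda>n. wprob w (b n)) \<longlonglongrightarrow> 0"
  proof (rule LIMSEQ_I)
    fix e :: real assume e: "0 < e"
    have "\<exists>n. wprob w (b n) < e"
    proof (rule ccontr)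
      assume "\<not> ?thesis"
      then have "\<And>n. e \<le> wprob w (b n)" by (simp add: not_less)
      from world_of_large_chain[OF w, of b e, OF b_in dec e this]
      obtain v where "world v" "\<And>n. b n \<in> v" by blast
      then have "v \<in> truth_set (b n)" for n by (simp add: truth_set_def worlds_def)
      then show False using X(3) by (auto simp: truth_set_b)
    qed
    then obtain n where n: "wprob w (b n) < e" by blast
    have "norm (wprob w (b m) - 0) < e" if "n \<le> m" for m
      using mono[OF that] n wprob_nonneg[OF w b_in[of m]] by simp
    then show "\<exists>n. \<forall>m\<ge>n. norm (wprob w (b m) - 0) < e" by blast
  qed
  then have "(\<lambda>n. ennreal (wprob w (b n))) \<longlonglongrightarrow> ennreal 0" by (rule tendsto_ennrealI)
  then show ?thesis by (simp add: premeasure_truth_set[OF b_in, unfolded truth_set_b])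
qed

lemma measure_exists:
  "\<exists>N. space N = worlds \<and> sets N = sigma_sets worlds (truth_set ` A) \<and>
     (\<forall>a\<in>A. emeasure N (truth_set a) = ennreal (wprob w a))"
proof -
  interpret algebra worlds "truth_set ` A" by (rule algebra_truth_set)
  have "\<exists>\<mu> :: 'p fm set set \<Rightarrow> ennreal. (\<forall>X \<in> truth_set ` A. \<mu> X = premeasure X) \<and>
      measure_space worlds (sigma_sets worlds (truth_set ` A)) \<mu>"
  proof (rule caratheodory_empty_continuous)
    show "positive (truth_set ` A) premeasure" by (simp add: positive_def premeasure_empty)
    show "additive (truth_set ` A) premeasure" by (rule premeasure_additive)
    show "premeasure X \<noteq> \<infinity>" for X by (simp add: premeasure_def)
  qed (rule premeasure_continuous)
  then obtain \<mu> where \<mu>: "\<And>X. X \<in> truth_set ` A \<Longrightarrow> \<mu> X = premeasure X"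
      "measure_space worlds (sigma_sets worlds (truth_set ` A)) \<mu>" by blast
  define N where "N = measure_of worlds (truth_set ` A) \<mu>"
  have sN: "sets N = sigma_sets worlds (truth_set ` A)" by (simp add: N_def sets_measure_of[OF truth_set_subset_Pow])
  have "emeasure N (truth_set a) = ennreal (wprob w a)" if a: "a \<in> A" for a
  proof -
    have "emeasure N (truth_set a) = \<mu> (truth_set a)"
      by (rule emeasure_measure_of[OF N_def truth_set_subset_Pow])
        (use \<mu>(2) a in \<open>auto simp: sN measure_space_def\<close>)
    then show ?thesis using \<mu>(1)[of "truth_set a"] a premeasure_truth_set[OF a] by simp
  qed
  then show ?thesis
    using sN by (intro exI[of _ N]) (simp add: N_def space_measure_of[OF truth_set_subset_Pow])
qed

end

definition world_space :: "'p fm set measure" where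
  "world_space = sigma worlds (truth_set ` A)"

definition trans_prob :: "'p fm set \<Rightarrow> 'p fm set measure" where
  "trans_prob w = (SOME N. space N = worlds \<and> sets N = sigma_sets worlds (truth_set ` A) \<and>
     (\<forall>a\<in>A. emeasure N (truth_set a) = ennreal (wprob w a)))"

definition next_world :: "'p fm set \<Rightarrow> 'p fm set" where
  "next_world w = {a \<in> A. Next a \<in> w}"

text \<open>Propositional variables outside the language occur in none of its formulas; they
  are given an arbitrary measurable set.\<close>

definition canonical_val :: "'p \<Rightarrow> 'p fm set set" where
  "canonical_val p = (if Prop p \<in> A then truth_set (Prop p) else {})"

lemma trans_prob:
  assumes "world w"
  shows "space (trans_prob w) = worlds" "sets (trans_prob w) = sigma_sets worlds (truth_set ` A)"
    "\<And>a. a \<in> A \<Longrightarrow> emeasure (trans_prob w) (truth_set a) = ennreal (wprob w a)"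
  using someI_ex[OF measure_exists[OF assms]] unfolding trans_prob_def[symmetric] by blast+

lemma space_world_space: "space world_space = worlds"
  and sets_world_space: "sets world_space = sigma_sets worlds (truth_set ` A)"
  by (simp_all add: world_space_def space_measure_of[OF truth_set_subset_Pow] sets_measure_of[OF truth_set_subset_Pow])

lemma truth_set_in_sets: "a \<in> A \<Longrightarrow> truth_set a \<in> sets world_space"
  by (simp add: sets_world_space)

lemma world_provable_Iff:
  assumes w: "world w" and ab: "provable (Iff a b)" and in_A: "a \<in> A" "b \<in> A"
  shows "a \<in> w \<longleftrightarrow> b \<in> w"
proof -
  have "provable (Imp a b)" "provable (Imp b a)"
    by (rule provable_conseq1[OF ab], simp add: Iff_def)+
  then show ?thesis using world_conseq[OF w] in_A by blast
qed

text \<open>Next commutes with negation and with countable conjunctions, provably, and theorems are closed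
  under it. The axiom for conjunctions can be used at \<open>w\<close> because \<open>Conj (map_option Next \<circ> F)\<close>
  belongs to the language.\<close>

lemma next_world:
  assumes w: "world w"
  shows "world (next_world w)"
  unfolding world_def
proof (intro conjI ballI allI impI)
  show "next_world w \<subseteq> A" by (auto simp: next_world_def)
  show "a \<in> next_world w" if "a \<in> A" "provable a" for a
    using world_provable[OF w provable_next[OF that(2)]] that by (simp add: next_world_def in_simps)
  show "Neg a \<in> next_world w \<longleftrightarrow> a \<notin> next_world w" if a: "a \<in> A" for a
  proof -
    have "Next (Neg a) \<in> w \<longleftrightarrow> Neg (Next a) \<in> w"
      by (rule world_provable_Iff[OF w provable.ax[OF is_axiom.next_neg]])
        (simp_all add: a in_simps)
    then show ?thesis using a world_Neg[OF w, of "Next a"] by (simp add: next_world_def in_simps)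
  qed
  show "Conj F \<in> next_world w \<longleftrightarrow> (\<forall>a\<in>ran F. a \<in> next_world w)" if F: "Conj F \<in> A" for F
  proof -
    have "Next (Conj F) \<in> w \<longleftrightarrow> Conj (map_option Next \<circ> F) \<in> w"
      by (rule world_provable_Iff[OF w provable.ax[OF is_axiom.next_conj] _ Conj_Next[OF F]])
        (simp add: F in_simps)
    also have "\<dots> \<longleftrightarrow> (\<forall>a\<in>ran F. Next a \<in> w)"
      unfolding world_Conj[OF w Conj_Next[OF F]] ran_map_option by simp
    finally have "Next (Conj F) \<in> w \<longleftrightarrow> (\<forall>a\<in>ran F. Next a \<in> w)" .
    then show ?thesis using F Conj_ran[OF F] unfolding next_world_def by blast
  qed
qed

lemma measurable_next_world: "next_world \<in> world_space \<rightarrow>\<^sub>M world_space"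
proof (rule measurable_sigma_sets[OF sets_world_space truth_set_subset_Pow])
  show "next_world \<in> space world_space \<rightarrow> worlds"
    using next_world by (auto simp: space_world_space worlds_def)
  fix X assume "X \<in> truth_set ` A"
  then obtain a where a: "a \<in> A" "X = truth_set a" by blast
  have "next_world -` X \<inter> space world_space = truth_set (Next a)"
    using next_world a by (auto simp: space_world_space worlds_def truth_set_def next_world_def)
  then show "next_world -` X \<inter> space world_space \<in> sets world_space"
    using truth_set_in_sets[of "Next a"] a by (simp add: in_simps)
qed

text \<open>A probability exceeds \<open>x\<close> iff one of countably many likelihood formulas holds.\<close>

lemma measurable_wprob:
  assumes a: "a \<in> A"
  shows "(\<lambda>w. wprob w a) \<in> borel_measurable world_space"
  unfolding borel_measurable_iff_greater
proof
  fix x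
  have "{w \<in> space world_space. x < wprob w a} = (\<Union>r\<in>{r. x < real_index r}. truth_set (Lik r a))"
    using less_wprob_iff[OF _ a] by (auto simp: space_world_space worlds_def truth_set_def)
  moreover have "(\<Union>r\<in>{r. x < real_index r}. truth_set (Lik r a)) \<in> sets world_space"
    by (intro sets.countable_UN' countable_subset[OF subset_UNIV countable_index])
      (auto intro!: truth_set_in_sets simp: a in_simps)
  ultimately show "{w \<in> space world_space. x < wprob w a} \<in> sets world_space" by simp
qed

lemma measurable_trans_prob: "trans_prob \<in> world_space \<rightarrow>\<^sub>M prob_algebra world_space"
proof (rule measurable_prob_algebra_generated[OF sets_world_space _ truth_set_subset_Pow])
  show "Int_stable (truth_set ` A)"
    by (rule Int_stableI) (auto simp: truth_set_And[symmetric] And_in)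
  fix w assume "w \<in> space world_space"
  then have w: "world w" by (simp add: space_world_space worlds_def)
  show "prob_space (trans_prob w)"
  proof
    obtain a where a: "a \<in> A" using nonempty_A by blast
    have "wprob w (Imp a a) = 1"
      by (rule wprob_provable[OF w provable_taut]) (simp_all add: a in_simps)
    then show "emeasure (trans_prob w) (space (trans_prob w)) = 1"
      using trans_prob(3)[OF w, of "Imp a a"] by (simp add: trans_prob(1)[OF w] truth_set_Imp_self a in_simps)
  qed
  show "sets (trans_prob w) = sets world_space"
    by (simp add: trans_prob(2)[OF w] sets_world_space)
next
  fix X assume "X \<in> truth_set ` A"
  then obtain a where a: "a \<in> A" "X = truth_set a" by blast
  have "(\<lambda>w. ennreal (wprob w a)) \<in> borel_measurable world_space"
    using measurable_wprob[OF a(1)] by measurable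
  then show "(\<lambda>w. emeasure (trans_prob w) X) \<in> borel_measurable world_space"
    by (subst measurable_cong[where g = "\<lambda>w. ennreal (wprob w a)"])
      (auto simp: space_world_space worlds_def a trans_prob(3))
qed

lemma is_model_canonical:
  assumes "worlds \<noteq> {}"
  shows "is_model world_space trans_prob next_world canonical_val"
  unfolding is_model_def dynamic_markov_process_def
  using assms measurable_trans_prob measurable_next_world truth_set_in_sets
  by (auto simp: space_world_space canonical_val_def)

lemma truth_lemma:
  "a \<in> A \<Longrightarrow> world w \<Longrightarrow> sat world_space trans_prob next_world canonical_val a w \<longleftrightarrow> a \<in> w"
proof (induction a arbitrary: w)
  case (Prop p)
  then show ?case by (simp add: canonical_val_def truth_set_def worlds_def)
next
  case (Neg a)
  have "a \<in> A" using Neg.prems(1) by (simp add: Neg_iff)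
  then show ?case using Neg.IH[of w] Neg.prems(2) world_Neg[of w a] by simp
next
  case (Conj F)
  have "sat world_space trans_prob next_world canonical_val a w \<longleftrightarrow> a \<in> w" if aF: "a \<in> ran F" for a
  proof -
    obtain i where i: "F i = Some a" using aF by (auto simp: ran_def)
    have "a \<in> A" by (rule Conj_ran[OF Conj.prems(1) aF])
    moreover have "F i \<in> range F" by (rule rangeI)
    moreover have "a \<in> set_option (F i)" using i by simp
    ultimately show ?thesis using Conj.IH Conj.prems(2) by blast
  qed
  moreover have "sat world_space trans_prob next_world canonical_val (Conj F) w \<longleftrightarrow>
      (\<forall>a\<in>ran F. sat world_space trans_prob next_world canonical_val a w)"
    unfolding sat_Conj_iff by (auto simp: ran_def)
  ultimately show ?case using world_Conj[OF Conj.prems(2,1)] by blast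
next
  case (Lik r a)
  have a: "a \<in> A" using Lik.prems(1) by (simp add: Lik_iff)
  have "{u \<in> space world_space. sat world_space trans_prob next_world canonical_val a u} = truth_set a"
    using Lik.IH[OF a] by (auto simp: space_world_space worlds_def truth_set_def)
  moreover have "measure (trans_prob w) (truth_set a) = wprob w a"
    using trans_prob(3)[OF Lik.prems(2) a] wprob_nonneg[OF Lik.prems(2) a] by (simp add: measure_def)
  ultimately show ?case unfolding sat.simps Lik_in_world_iff[OF Lik.prems(2) a] by simp
next
  case (Next a)
  have a: "a \<in> A" using Next.prems(1) by (simp add: Next_iff)
  have "sat world_space trans_prob next_world canonical_val a (next_world w) \<longleftrightarrow> a \<in> next_world w"
    by (rule Next.IH[OF a next_world[OF Next.prems(2)]])
  then show ?case using a unfolding sat.simps by (simp add: next_world_def)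
qed

end

section \<open>Completeness\<close>

text \<open>The unary closure conditions of a closed language: the subformulas one level down, and the formulas
  that the canonical model needs.\<close>

definition immediate :: "'p fm \<Rightarrow> 'p fm set" where
  "immediate a = {Neg a, Next a} \<union> range (\<lambda>r. Lik r a) \<union> range (\<lambda>r. arch_conj r a) \<union>
     (case a of Prop p \<Rightarrow> {} | Neg b \<Rightarrow> {b} | Lik r b \<Rightarrow> {b} | Next b \<Rightarrow> {b}
      | Conj F \<Rightarrow> ran F \<union> {Conj (map_option Next \<circ> F), continuity F})"

inductive_set generated :: "'p fm \<Rightarrow> 'p fm set" for c where
  base: "c \<in> generated c"
| step: "a \<in> generated c \<Longrightarrow> b \<in> immediate a \<Longrightarrow> b \<in> generated c"
| And: "a \<in> generated c \<Longrightarrow> b \<in> generated c \<Longrightarrow> And a b \<in> generated c"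

lemma countable_immediate: "countable (immediate a)"
  unfolding immediate_def
  by (auto intro!: countable_Un countable_image countable_index countable_ran_map split: fm.split)

lemma countable_generated: "countable (generated c)"
proof -
  define S where "S = rec_nat {c} (\<lambda>_ X. X \<union> (\<Union>a\<in>X. immediate a) \<union> (\<lambda>(a, b). And a b) ` (X \<times> X))"
  have S: "S 0 = {c}"
    "S (Suc n) = S n \<union> (\<Union>a\<in>S n. immediate a) \<union> (\<lambda>(a, b). And a b) ` (S n \<times> S n)" for n
    by (simp_all add: S_def)
  have "countable (S n)" for n
  proof (induction n)
    case (Suc n)
    then show ?case unfolding S
      by (intro countable_Un countable_UN countable_image countable_SIGMA) (auto intro: countable_immediate)
  qed (simp add: S)
  then have "countable (\<Union>n. S n)" by simp
  have mono: "S n \<subseteq> S m" if "n \<le> m" for n m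
    by (rule lift_Suc_mono_le[of S, OF _ that]) (auto simp: S)
  have "a \<in> (\<Union>n. S n)" if "a \<in> generated c" for a
    using that
  proof induction
    case base
    then show ?case using S(1) by blast
  next
    case (step a b)
    then obtain n where "a \<in> S n" by blast
    then have "b \<in> S (Suc n)" using step.hyps(2) by (auto simp: S)
    then show ?case by blast
  next
    case (And a b)
    then obtain n m where "a \<in> S n" "b \<in> S m" by blast
    then have "a \<in> S (max n m)" "b \<in> S (max n m)" using mono[of n "max n m"] mono[of m "max n m"] by auto
    then have "And a b \<in> S (Suc (max n m))" by (auto simp: S)
    then show ?case by blast
  qed
  then show ?thesis using \<open>countable (\<Union>n. S n)\<close> by (meson countable_subset subsetI)
qed

lemma closed_language_generated: "closed_language (generated c)"
proof
  show "countable (generated c)" by (rule countable_generated)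
  show "generated c \<noteq> {}" using generated.base by blast
  show "Neg a \<in> generated c \<longleftrightarrow> a \<in> generated c" for a
    using generated.step[of a c "Neg a"] generated.step[of "Neg a" c a] by (auto simp: immediate_def)
  show "Lik r a \<in> generated c \<longleftrightarrow> a \<in> generated c" for r a
    using generated.step[of a c "Lik r a"] generated.step[of "Lik r a" c a] by (auto simp: immediate_def)
  show "Next a \<in> generated c \<longleftrightarrow> a \<in> generated c" for a
    using generated.step[of a c "Next a"] generated.step[of "Next a" c a] by (auto simp: immediate_def)
  show "And a b \<in> generated c" if "a \<in> generated c" "b \<in> generated c" for a b
    using that by (rule generated.And)
  show "a \<in> generated c" if "Conj F \<in> generated c" "F i = Some a" for F i a
    using generated.step[OF that(1), of a] that(2) by (auto simp: immediate_def ran_def)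
  show "Conj (map_option Next \<circ> F) \<in> generated c" if "Conj F \<in> generated c" for F
    using generated.step[OF that, of "Conj (map_option Next \<circ> F)"] by (simp add: immediate_def)
  show "arch_conj r a \<in> generated c" if "a \<in> generated c" for r a
    using generated.step[OF that, of "arch_conj r a"] by (simp add: immediate_def)
  show "continuity F \<in> generated c" if "Conj F \<in> generated c" for F
    using generated.step[OF that, of "continuity F"] by (simp add: immediate_def)
qed

theorem theorem3p21:
  fixes A \<Gamma> :: "'p::countable fm set" and \<phi> :: "'p fm"
  assumes "countable_fragment A"
    and "\<Gamma> \<union> {\<phi>} \<subseteq> A"
    and "entails TYPE('p fm set) \<Gamma> \<phi>"
  shows "derives \<Gamma> \<phi>"
proof -
  have count: "countable \<Gamma>"
    using assms(1,2) countable_subset by (auto simp: countable_fragment_def)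
  have "provable (Imp (conj_set \<Gamma>) \<phi>)"
  proof (rule ccontr)
    assume not: "\<not> ?thesis"
    define c where "c = And (conj_set \<Gamma>) (Neg \<phi>)"
    interpret closed_language "generated c" by (rule closed_language_generated)
    have "\<not> provable (Neg c)"
    proof
      assume "provable (Neg c)"
      then have "provable (Imp (conj_set \<Gamma>) \<phi>)" by (rule provable_conseq1) (simp add: c_def)
      then show False using not by simp
    qed
    then obtain w where w: "world w" "c \<in> w" using world_exists generated.base by blast
    have in_generated: "conj_set \<Gamma> \<in> generated c" "\<phi> \<in> generated c"
      using And_sub[of "conj_set \<Gamma>" "Neg \<phi>", folded c_def] generated.base[of c]
      by (simp_all add: Neg_iff)
    have sub: "\<gamma> \<in> generated c" if "\<gamma> \<in> \<Gamma>" for \<gamma>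
      using Conj_ran[OF in_generated(1)[unfolded conj_set_def]] that ran_enumeration[OF count] by blast
    have mem: "conj_set \<Gamma> \<in> w" "\<phi> \<notin> w"
      using world_And[OF w(1), of "conj_set \<Gamma>" "Neg \<phi>", folded c_def] world_Neg[OF w(1), of \<phi>]
        w(2) in_generated by (auto simp: Neg_iff)
    have "sat world_space trans_prob next_world canonical_val \<gamma> w" if "\<gamma> \<in> \<Gamma>" for \<gamma>
      using truth_lemma[OF sub[OF that] w(1)] world_conj_set[OF w(1) count in_generated(1)] mem(1) that by blast
    moreover have "\<not> sat world_space trans_prob next_world canonical_val \<phi> w"
      using truth_lemma[OF in_generated(2) w(1)] mem(2) by blast
    moreover have "is_model world_space trans_prob next_world canonical_val" "w \<in> space world_space"
      using w(1) by (auto intro!: is_model_canonical simp: space_world_space worlds_def)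
    ultimately show False using assms(3) unfolding entails_def by blast
  qed
  then show ?thesis by (rule derives_of_provable_conj[OF count])
qed

end
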